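(* Let $N_c,N_x,N_t,N_r\ge 1$ be integers, let $\sigma_n^2>0$, and let $\mathbf X=\mathrm{diag}\{\mathbf X(0),\dots,\mathbf X(N_c-1)\}\in\mathbb C^{N_cN_x\times N_cN_t}$ be a known (fixed) block diagonal matrix with blocks $\mathbf X(p)\in\mathbb C^{N_x\times N_t}$. Consider the sensing model $$\mathbf Y_{\rm rad}=\mathbf X\mathbf G+\mathbf W_{\rm rad},$$ where $\mathbf G\in\mathbb C^{N_cN_t\times N_r}$ is a random matrix whose $N_r$ columns are independent, zero-mean circularly symmetric complex Gaussian vectors with common covariance matrix $\Sigma_{\mathbf G}=E\{\mathbf G\mathbf G^H\}/N_r$, and $\mathbf W_{\rm rad}\in\mathbb C^{N_cN_x\times N_r}$ is independent of $\mathbf G$ with i.i.d. $\mathcal{CN}(0,\sigma_n^2)$ entries. Then the sensing mutual information is $$I(\mathbf G;\mathbf Y_{\rm rad}|\mathbf X)=N_r\log_2\left[(\sigma_n^2)^{-N_xN_c}\det\left(\mathbf X\Sigma_{\mathbf G}\mathbf X^H+\sigma_n^2\mathbf I_{N_xN_c}\right)\right].$$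
   Context: The sensing mutual information (in bits) is the mutual information between the sensing channel $\mathbf G$ and the echo $\mathbf Y_{\rm rad}$ given the known transmitted signal $\mathbf X$, and is given by $I(\mathbf G;\mathbf Y_{\rm rad}|\mathbf X)=h(\mathbf Y_{\rm rad}|\mathbf X)-h(\mathbf W_{\rm rad})$, where $h$ denotes differential entropy with base-2 logarithm and $\mathbf X$ is treated as a fixed matrix. $\mathcal{CN}(0,\sigma^2)$ is the circularly symmetric complex Gaussian law with variance $\sigma^2$, $(\cdot)^H$ is conjugate transpose, $\mathbf I_n$ is the $n\times n$ identity, and $\mathrm{diag}\{\cdot\}$ is a block diagonal matrix. *)

theory Defs
  imports "HOL-Probability.Probability"
begin

text \<open>
  An \<open>m \<times> n\<close> complex matrix has type \<open>complex^'n^'m\<close> (the row index type is outermost).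
  Block indices are pairs: \<open>(p, i)\<close> is position \<open>i\<close> inside block \<open>p\<close>.
  Complex vectors and matrices are Euclidean spaces over the reals, so \<^term>\<open>lborel\<close> on them is
  Lebesgue measure in the real and imaginary parts of all entries, and
  \<open>entropy 2 lborel Y\<close> is the differential entropy of \<open>Y\<close> in bits.
\<close>

definition ctranspose :: "complex^'n^'m \<Rightarrow> complex^'m^'n" where
  "ctranspose A = (\<chi> i j. cnj (A $ j $ i))"

definition block_diag ::
    "('c \<Rightarrow> complex^'t^'x) \<Rightarrow> complex^('c::finite \<times> 't::finite)^('c \<times> 'x::finite)" where
  "block_diag B = (\<chi> a b. if fst a = fst b then B (fst a) $ snd a $ snd b else 0)"

text \<open>Point masses count as normal laws (zero variance), so singular covariances are allowed.\<close>

definition normal_law :: "real measure \<Rightarrow> bool" where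
  "normal_law N \<longleftrightarrow>
     (\<exists>\<mu>. N = return borel \<mu>) \<or>
     (\<exists>\<mu> \<sigma>. 0 < \<sigma> \<and> N = density lborel (\<lambda>x. ennreal (normal_density \<mu> \<sigma> x)))"

text \<open>
  On \<open>complex^'n\<close> the real inner product with \<open>a\<close> ranges over all real linear combinations of the
  real and imaginary parts of the entries, so this is joint Gaussianity of these \<open>2n\<close> real variables.
\<close>

definition jointly_gaussian :: "'w measure \<Rightarrow> ('w \<Rightarrow> 'v::euclidean_space) \<Rightarrow> bool" where
  "jointly_gaussian M Z \<longleftrightarrow>
     Z \<in> borel_measurable M \<and> (\<forall>a. normal_law (distr M borel (\<lambda>\<omega>. a \<bullet> Z \<omega>)))"

definition circularly_symmetric :: "'w measure \<Rightarrow> ('w \<Rightarrow> complex^'n) \<Rightarrow> bool" where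
  "circularly_symmetric M Z \<longleftrightarrow>
     (\<forall>\<theta>. distr M borel (\<lambda>\<omega>. cis \<theta> *s Z \<omega>) = distr M borel Z)"

definition cs_complex_gaussian :: "'w measure \<Rightarrow> ('w \<Rightarrow> complex^'n) \<Rightarrow> bool" where
  "cs_complex_gaussian M Z \<longleftrightarrow> jointly_gaussian M Z \<and> circularly_symmetric M Z"

definition mean_vec :: "'w measure \<Rightarrow> ('w \<Rightarrow> complex^'n) \<Rightarrow> complex^'n" where
  "mean_vec M Z = (LINT \<omega>|M. Z \<omega>)"

definition covariance_mat :: "'w measure \<Rightarrow> ('w \<Rightarrow> complex^'n) \<Rightarrow> complex^'n^'n" where
  "covariance_mat M Z =
     (LINT \<omega>|M. (\<chi> i j. (Z \<omega> - mean_vec M Z) $ i * cnj ((Z \<omega> - mean_vec M Z) $ j)))"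

text \<open>
  Density of the scalar law \<open>CN(0, v)\<close>, where \<open>v = E |z|^2\<close>; equivalently, the real and imaginary
  parts are independent real normal variables with mean \<open>0\<close> and variance \<open>v / 2\<close>.
\<close>

definition cn_density :: "real \<Rightarrow> complex \<Rightarrow> real" where
  "cn_density v z = exp (- (cmod z)\<^sup>2 / v) / (pi * v)"

lemma cn_density_eq_normal_density:
  assumes "0 < v"
  shows "cn_density v z =
    normal_density 0 (sqrt (v / 2)) (Re z) * normal_density 0 (sqrt (v / 2)) (Im z)"
proof -
  have "sqrt (pi * v) * sqrt (pi * v) = pi * v"
    using assms by simp
  then show ?thesis
    using assms
    by (simp add: cn_density_def normal_density_def cmod_power2 exp_add [symmetric]
        add_divide_distrib [symmetric] algebra_simps)
qed

text \<open>
  The library's \<open>indep_var\<close> requires both variables to have the same value type; the following is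
  its characterization \<open>indep_var_eq\<close> without that restriction.
\<close>

definition indep_rv ::
    "'w measure \<Rightarrow> 'a measure \<Rightarrow> ('w \<Rightarrow> 'a) \<Rightarrow> 'b measure \<Rightarrow> ('w \<Rightarrow> 'b) \<Rightarrow> bool" where
  "indep_rv M S X T Y \<longleftrightarrow>
     (X \<in> measurable M S \<and> Y \<in> measurable M T) \<and>
     prob_space.indep_set M
       (sigma_sets (space M) {X -` A \<inter> space M | A. A \<in> sets S})
       (sigma_sets (space M) {Y -` A \<inter> space M | A. A \<in> sets T})"

lemma (in prob_space) indep_rv_iff_indep_var: "indep_rv M S X T Y \<longleftrightarrow> indep_var S X T Y"
  by (simp add: indep_rv_def indep_var_eq)

end

theory Submission
  imports Defs
begin

text \<open>
  Conditionally on \<open>G\<close>, the echo \<open>Y\<close> is the isotropic Gaussian \<open>W\<close> shifted by \<open>X G\<close>. Hence, relative to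
  the law of \<open>G\<close> times Lebesgue measure, \<open>(G, Y)\<close> has density \<open>f\<^sub>W (y - X g)\<close>, and the mutual information
  is \<open>E (log f\<^sub>W W) - E (log f\<^sub>Y Y) = h(Y) - h(W)\<close>. Diagonalize the Hermitian matrix
  \<open>X \<Sigma> X\<^sup>H\<close> by a unitary matrix. In the resulting orthonormal coordinates, \<open>f\<^sub>Y\<close>, which is the average
  of the translates of \<open>f\<^sub>W\<close>, is a product of one-dimensional normal densities of variances
  \<open>(\<sigma>\<^sub>i + s) / 2\<close>, where \<open>s\<close> is the noise power. Each eigenvalue occurs once for the
  real and once for the imaginary part of every column, so adding up one-dimensional entropies gives
  the logarithm of \<open>\<Prod>\<^sub>i (\<sigma>\<^sub>i + s) / s\<close> per column.
\<close>

subsection \<open>Fourier integrals of normal densities\<close>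

text \<open>The covariance may be singular, so \<open>G\<close> and \<open>X G\<close> may have no
  density, and the law of the echo cannot be found by convolving two densities. The noiseless echo
  therefore enters only through its characteristic function, and the Gaussian noise supplies the
  integrable factor that makes Fourier inversion possible. Circular symmetry lets the complex
  covariance alone determine this characteristic function: it makes the variance of a real
  functional one half of the corresponding Hermitian form. This is the origin of the halves in the
  real variances, and the complex noise power splits in the same way between real and imaginary
  parts.\<close>

lemma integral_normal_density_iexp:
  assumes [arith]: "0 < \<sigma>"
  shows "(CLINT x|lborel. normal_density 0 \<sigma> x *\<^sub>R iexp (t * x)) = complex_of_real (exp (- (\<sigma> * t)\<^sup>2 / 2))"
proof -
  have "normal_density 0 \<sigma> (\<sigma> * x) = std_normal_density x / \<sigma>" for x
    by (simp add: normal_density_def real_sqrt_mult power_mult_distrib)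
  then have "(CLINT x|lborel. normal_density 0 \<sigma> x *\<^sub>R iexp (t * x))
      = (CLINT x|lborel. std_normal_density x *\<^sub>R iexp (\<sigma> * t * x))"
    by (subst lborel_integral_real_affine[where c = \<sigma> and t = 0])
       (simp_all add: mult_ac integral_scaleR_right[symmetric] del: integral_scaleR_right)
  also have "\<dots> = char std_normal_distribution (\<sigma> * t)"
    unfolding char_def by (subst integral_density) simp_all
  finally show ?thesis
    by (simp add: char_std_normal_distribution)
qed

lemma integrable_normal_density_iexp:
  assumes "0 < \<sigma>"
  shows "complex_integrable lborel (\<lambda>x. normal_density 0 \<sigma> x *\<^sub>R iexp (t * x))"
  by (rule Bochner_Integration.integrable_bound[OF integrable_normal_density[OF assms, of 0]])
     (auto simp: norm_mult)

text \<open>A Gaussian is its own Fourier transform up to scaling, with \<sigma> replaced by its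
  reciprocal. This lets the forward transform be applied a second time.\<close>

lemma exp_eq_normal_density:
  assumes "0 < \<sigma>"
  shows "exp (- (\<sigma> * t)\<^sup>2 / 2) = sqrt (2 * pi) / \<sigma> * normal_density 0 (1 / \<sigma>) t"
  using assms by (simp add: normal_density_def real_sqrt_mult real_sqrt_divide power_mult_distrib field_simps)

text \<open>Fourier inversion for the normal density, obtained from the forward transform at
  standard deviation \<open>1 / \<sigma>\<close>; the factor \<open>2 * pi\<close> is the usual
  inversion constant.\<close>

lemma
  assumes "0 < \<sigma>"
  shows integral_exp_square_iexp: "(CLINT t|lborel. exp (- (\<sigma> * t)\<^sup>2 / 2) *\<^sub>R iexp (x * t))
      = complex_of_real (2 * pi * normal_density 0 \<sigma> x)"
    and integrable_exp_square_iexp: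
      "complex_integrable lborel (\<lambda>t. exp (- (\<sigma> * t)\<^sup>2 / 2) *\<^sub>R iexp (x * t))"
proof -
  have *: "sqrt (2 * pi) / \<sigma> * exp (- (1 / \<sigma> * x)\<^sup>2 / 2) = 2 * pi * normal_density 0 \<sigma> x"
    using assms by (simp add: normal_density_def real_sqrt_mult power_mult_distrib power_divide field_simps)
  have eq: "exp (- (\<sigma> * t)\<^sup>2 / 2) *\<^sub>R iexp (x * t)
      = (sqrt (2 * pi) / \<sigma>) *\<^sub>R (normal_density 0 (1 / \<sigma>) t *\<^sub>R iexp (x * t))" for t
    using assms by (subst exp_eq_normal_density) auto
  show "complex_integrable lborel (\<lambda>t. exp (- (\<sigma> * t)\<^sup>2 / 2) *\<^sub>R iexp (x * t))"
    unfolding eq using assms by (intro integrable_scaleR_right integrable_normal_density_iexp) auto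
  have "(CLINT t|lborel. exp (- (\<sigma> * t)\<^sup>2 / 2) *\<^sub>R iexp (x * t))
      = (sqrt (2 * pi) / \<sigma>) *\<^sub>R complex_of_real (exp (- (1 / \<sigma> * x)\<^sup>2 / 2))"
    unfolding eq integral_scaleR_right using assms
    by (subst integral_normal_density_iexp) auto
  also have "\<dots> = complex_of_real (2 * pi * normal_density 0 \<sigma> x)"
    unfolding *[symmetric] by (simp add: scaleR_conv_of_real)
  finally show "(CLINT t|lborel. exp (- (\<sigma> * t)\<^sup>2 / 2) *\<^sub>R iexp (x * t))
      = complex_of_real (2 * pi * normal_density 0 \<sigma> x)" .
qed

text \<open>
  Replacing the Gaussian density by its Fourier integral brings in only the characteristic function
  of \<open>N\<close>; no uniqueness theorem for multivariate characteristic functions is needed, and \<open>N\<close> may be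
  singular.
\<close>

lemma gaussian_smoothing:
  fixes N :: "'e::euclidean_space measure" and e :: "'i \<Rightarrow> 'e"
  assumes "prob_space N" and sets_N[measurable_cong]: "sets N = sets borel"
    and fin: "finite I" and v: "0 < v" and l: "\<And>j. j \<in> I \<Longrightarrow> 0 \<le> l j"
    and ch: "\<And>\<tau>. (CLINT h|N. iexp (\<Sum>j\<in>I. \<tau> j * (e j \<bullet> h)))
        = complex_of_real (exp (- (\<Sum>j\<in>I. l j * (\<tau> j)\<^sup>2) / 2))"
  shows "(LINT h|N. (\<Prod>j\<in>I. normal_density 0 (sqrt v) (e j \<bullet> (y - h))))
      = (\<Prod>j\<in>I. normal_density 0 (sqrt (l j + v)) (e j \<bullet> y))"
proof -
  interpret N: prob_space N by fact
  interpret L: product_sigma_finite "\<lambda>_::'i. lborel :: real measure" ..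
  interpret P: sigma_finite_measure "\<Pi>\<^sub>M j\<in>I. (lborel :: real measure)"
    by (rule L.sigma_finite) fact
  interpret NP: pair_sigma_finite N "\<Pi>\<^sub>M j\<in>I. (lborel :: real measure)" ..
  have mono: "l j + v > 0" if "j \<in> I" for j using l[OF that] v by simp
  \<comment> \<open>\<open>g j c\<close> is the Fourier integrand whose integral is
    \<open>2 * pi\<close> times the normal density of variance \<open>v\<close> at
    \<open>c\<close>.\<close>
  define g where "g j c t = exp (- (sqrt v * t)\<^sup>2 / 2) *\<^sub>R iexp (c * t)" for j :: 'i and c t :: real
  have [measurable]: "(\<lambda>h. e j \<bullet> (y - h)) \<in> borel_measurable N" for j
    by measurable
  have gi: "complex_integrable lborel (g j c)" for j c
    unfolding g_def using v by (intro integrable_exp_square_iexp) auto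
  have ng: "norm (g j c t) = exp (- (sqrt v * t)\<^sup>2 / 2)" for j c t
    by (simp add: g_def)
  have Gi: "integrable (\<Pi>\<^sub>M j\<in>I. lborel) (\<lambda>\<tau>. \<Prod>j\<in>I. g j (c j) (\<tau> j))" for c
    by (rule L.product_integrable_prod) (use fin gi in auto)
  define F where "F = (\<lambda>(h, \<tau>). \<Prod>j\<in>I. g j (e j \<bullet> (y - h)) (\<tau> j))"
  have [measurable]: "F \<in> borel_measurable (N \<Otimes>\<^sub>M (\<Pi>\<^sub>M j\<in>I. lborel))"
    unfolding F_def g_def by measurable
  \<comment> \<open>Each \<open>iexp\<close> has modulus 1, so the norm of \<open>F\<close> is free
    of \<open>h\<close>. As \<open>N\<close> is a probability measure, the Gaussian weights alone
    give joint integrability, and the integrals may be exchanged.\<close>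
  have Fi: "integrable (N \<Otimes>\<^sub>M (\<Pi>\<^sub>M j\<in>I. lborel)) F"
  proof (rule NP.Fubini_integrable)
    show "integrable N (\<lambda>h. LINT \<tau>|(\<Pi>\<^sub>M j\<in>I. lborel). norm (F (h, \<tau>)))"
      by (simp add: F_def prod_norm[symmetric] ng)
    show "AE h in N. integrable (\<Pi>\<^sub>M j\<in>I. lborel) (\<lambda>\<tau>. F (h, \<tau>))"
      unfolding F_def by (simp add: Gi)
  qed simp
  have inner: "(LINT \<tau>|(\<Pi>\<^sub>M j\<in>I. lborel). F (h, \<tau>))
      = complex_of_real ((2 * pi) ^ card I * (\<Prod>j\<in>I. normal_density 0 (sqrt v) (e j \<bullet> (y - h))))" for h
  proof -
    have "(LINT \<tau>|(\<Pi>\<^sub>M j\<in>I. lborel). F (h, \<tau>)) = (\<Prod>j\<in>I. integral\<^sup>L lborel (g j (e j \<bullet> (y - h))))"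
      unfolding F_def prod.case by (rule L.product_integral_prod) (use fin gi in auto)
    also have "\<dots> = (\<Prod>j\<in>I. complex_of_real (2 * pi * normal_density 0 (sqrt v) (e j \<bullet> (y - h))))"
      unfolding g_def using v by (subst integral_exp_square_iexp) auto
    finally show ?thesis by (simp add: prod.distrib)
  qed
  have outer: "(LINT h|N. F (h, \<tau>))
      = (\<Prod>j\<in>I. exp (- (sqrt (l j + v) * \<tau> j)\<^sup>2 / 2) *\<^sub>R iexp ((e j \<bullet> y) * \<tau> j))" for \<tau>
  proof -
    \<comment> \<open>Splitting \<open>y - h\<close> collects all dependence on \<open>h\<close> in
      one exponential with frequencies \<open>- \<tau>\<close>, where \<open>ch\<close>
      applies.\<close>
    have "F (h, \<tau>) = (\<Prod>j\<in>I. g j (e j \<bullet> y) (\<tau> j)) * iexp (\<Sum>j\<in>I. - \<tau> j * (e j \<bullet> h))" for h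
    proof -
      have "F (h, \<tau>) = (\<Prod>j\<in>I. g j (e j \<bullet> y) (\<tau> j) * iexp (- \<tau> j * (e j \<bullet> h)))"
        unfolding F_def prod.case g_def
        by (intro prod.cong refl) (simp add: inner_diff_right exp_add[symmetric] algebra_simps)
      also have "\<dots> = (\<Prod>j\<in>I. g j (e j \<bullet> y) (\<tau> j)) * iexp (\<Sum>j\<in>I. - \<tau> j * (e j \<bullet> h))"
        by (simp only: prod.distrib of_real_sum sum_distrib_left exp_sum[OF fin])
      finally show ?thesis .
    qed
    then have "(LINT h|N. F (h, \<tau>)) = (\<Prod>j\<in>I. g j (e j \<bullet> y) (\<tau> j)) *
        complex_of_real (exp (- (\<Sum>j\<in>I. l j * (\<tau> j)\<^sup>2) / 2))"
      using ch[of "\<lambda>j. - \<tau> j"] by simp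
    also have "complex_of_real (exp (- (\<Sum>j\<in>I. l j * (\<tau> j)\<^sup>2) / 2))
       = (\<Prod>j\<in>I. complex_of_real (exp (- (l j * (\<tau> j)\<^sup>2) / 2)))"
      by (simp add: sum_negf[symmetric] sum_divide_distrib exp_sum fin)
    also have "(\<Prod>j\<in>I. g j (e j \<bullet> y) (\<tau> j)) * \<dots>
        = (\<Prod>j\<in>I. exp (- (sqrt (l j + v) * \<tau> j)\<^sup>2 / 2) *\<^sub>R iexp ((e j \<bullet> y) * \<tau> j))"
      unfolding prod.distrib[symmetric]
    proof (rule prod.cong[OF refl])
      fix j assume j: "j \<in> I"
      \<comment> \<open>Variances add: the weight from the noise and the one from \<open>N\<close>
        multiply to a Gaussian weight with parameter \<open>l j + v\<close>.\<close>
      have "exp (- (sqrt (l j + v) * \<tau> j)\<^sup>2 / 2)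
          = exp (- (sqrt v * \<tau> j)\<^sup>2 / 2) * exp (- (l j * (\<tau> j)\<^sup>2) / 2)"
        using mono[OF j] v by (simp add: power_mult_distrib exp_add[symmetric] algebra_simps add_divide_distrib[symmetric] diff_divide_distrib[symmetric])
      then show "g j (e j \<bullet> y) (\<tau> j) * complex_of_real (exp (- (l j * (\<tau> j)\<^sup>2) / 2))
          = exp (- (sqrt (l j + v) * \<tau> j)\<^sup>2 / 2) *\<^sub>R iexp ((e j \<bullet> y) * \<tau> j)"
        by (simp add: g_def scaleR_conv_of_real)
    qed
    finally show ?thesis .
  qed
  have "complex_of_real ((2 * pi) ^ card I * (LINT h|N. (\<Prod>j\<in>I. normal_density 0 (sqrt v) (e j \<bullet> (y - h)))))
      = (LINT h|N. (LINT \<tau>|(\<Pi>\<^sub>M j\<in>I. lborel). F (h, \<tau>)))"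
    unfolding inner integral_complex_of_real by simp
  also have "\<dots> = (LINT \<tau>|(\<Pi>\<^sub>M j\<in>I. lborel). (LINT h|N. F (h, \<tau>)))"
    using NP.Fubini_integral[of "\<lambda>h \<tau>. F (h, \<tau>)"] Fi by simp
  also have "\<dots> = (\<Prod>j\<in>I. (CLINT t|lborel. exp (- (sqrt (l j + v) * t)\<^sup>2 / 2) *\<^sub>R iexp ((e j \<bullet> y) * t)))"
    unfolding outer
    by (rule L.product_integral_prod[OF fin], rule integrable_exp_square_iexp) (use mono in simp)
  also have "\<dots> = (\<Prod>j\<in>I. complex_of_real (2 * pi * normal_density 0 (sqrt (l j + v)) (e j \<bullet> y)))"
    by (intro prod.cong refl integral_exp_square_iexp) (use mono in auto)
  also have "\<dots> = complex_of_real ((2 * pi) ^ card I * (\<Prod>j\<in>I. normal_density 0 (sqrt (l j + v)) (e j \<bullet> y)))"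
    by (simp add: prod.distrib)
  finally show ?thesis
    unfolding of_real_eq_iff by simp
qed

subsection \<open>Isotropic Gaussian densities\<close>

text \<open>The density of N(0, v I), written through the norm so that it can be factored in any
  orthonormal coordinates; \<open>v\<close> is the variance of one real coordinate.\<close>

definition isotropic_density :: "real \<Rightarrow> 'e::euclidean_space \<Rightarrow> real" where
  "isotropic_density v w = exp (- (norm w)\<^sup>2 / (2 * v)) / sqrt (2 * pi * v) ^ DIM('e)"

text \<open>Rotation invariance: the exponent sees only the squared norm, which Parseval splits over
  the coordinates, and the cardinality makes the normalizing constants agree.\<close>

lemma isotropic_density_eq_prod:
  fixes w :: "'e::euclidean_space"
  assumes fin: "finite I" and card: "card I = DIM('e)" and v: "0 < v"
    and norm: "(norm w)\<^sup>2 = (\<Sum>j\<in>I. (e j \<bullet> w)\<^sup>2)"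
  shows "isotropic_density v w = (\<Prod>j\<in>I. normal_density 0 (sqrt v) (e j \<bullet> w))"
  using v unfolding isotropic_density_def norm card[symmetric] normal_density_def
  by (simp add: sum_negf[symmetric] sum_divide_distrib exp_sum[OF fin] prod_dividef)

lemma norm_power2_Basis: "(norm w)\<^sup>2 = (\<Sum>b\<in>Basis. (b \<bullet> w)\<^sup>2)"
  unfolding power2_norm_eq_inner
  by (subst euclidean_inner) (simp add: power2_eq_square inner_commute)

lemma norm_power2_vec:
  fixes w :: "'e::real_inner^'n"
  shows "(norm w)\<^sup>2 = (\<Sum>i\<in>UNIV. (norm (w $ i))\<^sup>2)"
  by (simp add: power2_norm_eq_inner inner_vec_def)

lemma isotropic_density_Basis:
  assumes v: "0 < v"
  shows "isotropic_density v w = (\<Prod>b\<in>Basis. normal_density 0 (sqrt v) (b \<bullet> w))"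
  using assms by (intro isotropic_density_eq_prod[where e = id, simplified] norm_power2_Basis) auto

text \<open>The complex plane has real dimension 2, and each of the two coordinates carries half of
  the complex variance.\<close>

lemma cn_density_eq_isotropic: "0 < s \<Longrightarrow> cn_density s z = isotropic_density (s / 2) z"
  by (simp add: cn_density_def isotropic_density_def)

lemma isotropic_density_matrix:
  fixes w :: "'e::euclidean_space^'r^'n"
  assumes "0 < v"
  shows "isotropic_density v w = (\<Prod>(a, r)\<in>UNIV. isotropic_density v (w $ a $ r))"
proof -
  have "(norm w)\<^sup>2 = (\<Sum>(a, r)\<in>UNIV. (norm (w $ a $ r))\<^sup>2)"
    by (simp add: norm_power2_vec sum.cartesian_product UNIV_Times_UNIV[symmetric] del: UNIV_Times_UNIV)
  then show ?thesis
    using assms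
    by (simp add: isotropic_density_def case_prod_unfold prod_dividef exp_sum[symmetric]
        sum_negf sum_divide_distrib power_mult[symmetric] mult_ac)
qed

lemma isotropic_density_pos: "0 < v \<Longrightarrow> 0 < isotropic_density v w"
  by (simp add: isotropic_density_def)

lemma borel_measurable_isotropic_density[measurable]: "isotropic_density v \<in> borel_measurable borel"
  unfolding isotropic_density_def by measurable

section \<open>Lebesgue measure on matrices and laws of independent entries\<close>

lemma prod_Basis_vec:
  fixes f :: "'e::euclidean_space^'n \<Rightarrow> 'b::comm_monoid_mult"
  shows "(\<Prod>b\<in>Basis. f b) = (\<Prod>i\<in>UNIV. \<Prod>b\<in>Basis. f (axis i b))"
proof -
  have "(\<Prod>b\<in>Basis. f b) = (\<Prod>p\<in>UNIV \<times> Basis. f (axis (fst p) (snd p)))"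
    by (rule prod.reindex_cong[where l = "\<lambda>p. axis (fst p) (snd p)"])
       (auto simp: inj_on_def axis_eq_axis Basis_vec_def image_iff, blast+)
  then show ?thesis
    by (simp add: prod.cartesian_product case_prod_unfold)
qed

text \<open>Lebesgue measure is determined by its values on boxes, and a box of matrices is a
  product of boxes of entries. This carries joint densities of the entries over to the matrix
  type.\<close>

lemma lborel_matrix:
  "distr (\<Pi>\<^sub>M p\<in>UNIV. lborel) borel (\<lambda>f. \<chi> a r. f (a, r)) = (lborel :: ('e::euclidean_space^'r^'n) measure)"
proof (rule lborel_eqI[symmetric])
  interpret L: product_sigma_finite "\<lambda>_::'n \<times> 'r. lborel :: 'e measure" ..
  have [measurable]: "(\<lambda>f. (\<chi> a r. f (a, r)) :: 'e^'r^'n) \<in> borel_measurable (\<Pi>\<^sub>M p\<in>UNIV. lborel)"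
    by (subst borel_measurable_euclidean_space) (auto simp: Basis_vec_def inner_axis)
  fix l u :: "'e^'r^'n"
  assume le: "\<And>b. b \<in> Basis \<Longrightarrow> l \<bullet> b \<le> u \<bullet> b"
  have "(\<lambda>f. \<chi> a r. f (a, r)) -` box l u \<inter> space (\<Pi>\<^sub>M p\<in>UNIV. lborel)
      = (\<Pi>\<^sub>E p\<in>UNIV. box (l $ fst p $ snd p) (u $ fst p $ snd p))"
    by (auto simp: space_PiM mem_box Basis_vec_def inner_axis PiE_iff)
  then have "emeasure (distr (\<Pi>\<^sub>M p\<in>UNIV. lborel) borel (\<lambda>f. \<chi> a r. f (a, r))) (box l u)
      = (\<Prod>p\<in>UNIV. emeasure lborel (box (l $ fst p $ snd p) (u $ fst p $ snd p)))"
    by (simp add: emeasure_distr L.emeasure_PiM)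
  also have "\<dots> = (\<Prod>p\<in>UNIV. ennreal (\<Prod>b\<in>Basis. (u $ fst p $ snd p - l $ fst p $ snd p) \<bullet> b))"
  proof (intro prod.cong refl emeasure_lborel_box)
    fix p b assume "b \<in> (Basis :: 'e set)"
    then have "axis (fst p) (axis (snd p) b) \<in> (Basis :: ('e^'r^'n) set)"
      by (auto simp: Basis_vec_def)
    from le[OF this] show "l $ fst p $ snd p \<bullet> b \<le> u $ fst p $ snd p \<bullet> b"
      by (simp add: inner_axis)
  qed
  also have "\<dots> = ennreal (\<Prod>p\<in>UNIV. \<Prod>b\<in>Basis. (u $ fst p $ snd p - l $ fst p $ snd p) \<bullet> b)"
  proof (intro prod_ennreal prod_nonneg)
    fix p b assume "b \<in> (Basis :: 'e set)"
    then have "axis (fst p) (axis (snd p) b) \<in> (Basis :: ('e^'r^'n) set)"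
      by (auto simp: Basis_vec_def)
    from le[OF this] show "0 \<le> (u $ fst p $ snd p - l $ fst p $ snd p) \<bullet> b"
      by (simp add: inner_axis inner_diff_left)
  qed
  also have "(\<Prod>p\<in>UNIV. \<Prod>b\<in>Basis. (u $ fst p $ snd p - l $ fst p $ snd p) \<bullet> b)
      = (\<Prod>b\<in>Basis. (u - l) \<bullet> b)"
    unfolding prod_Basis_vec
    by (simp add: inner_axis prod.cartesian_product[of "\<lambda>a r. \<Prod>b\<in>Basis. (u $ a $ r - l $ a $ r) \<bullet> b"]
        case_prod_unfold)
  finally show "emeasure (distr (\<Pi>\<^sub>M p\<in>UNIV. lborel) borel (\<lambda>f. \<chi> a r. f (a, r))) (box l u)
      = (\<Prod>b\<in>Basis. (u - l) \<bullet> b)" .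
qed simp

text \<open>Independence makes the joint law the product of the marginals, and a product measure is
  determined by measurable rectangles, on which the integral of the product density factors.\<close>

lemma (in prob_space) distributed_PiM_density:
  fixes g :: "'i::finite \<Rightarrow> 'e::euclidean_space \<Rightarrow> real"
  assumes ind: "indep_vars (\<lambda>_. borel) X UNIV"
    and X: "\<And>i. distributed M lborel (X i) (\<lambda>x. ennreal (g i x))"
    and g: "\<And>i x. 0 \<le> g i x"
  shows "distr M (\<Pi>\<^sub>M i\<in>UNIV. borel) (\<lambda>\<omega>. \<lambda>i\<in>UNIV. X i \<omega>)
    = density (\<Pi>\<^sub>M i\<in>UNIV. lborel) (\<lambda>f. ennreal (\<Prod>i\<in>UNIV. g i (f i)))"
proof -
  interpret L: product_sigma_finite "\<lambda>_::'i. lborel :: 'e measure" ..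
  have rv: "random_variable borel (X i)" for i
    using distributed_measurable[OF X, of i] by simp
  have [measurable]: "g i \<in> borel_measurable borel" for i
    using distributed_real_measurable[OF _ X, of i] g by simp
  have d: "distr M borel (X i) = density lborel (\<lambda>x. ennreal (g i x))" for i
    using distributed_distr_eq_density[OF X, of i] by (simp cong: distr_cong)
  interpret D: prob_space "distr M borel (X i)" for i
    by (rule prob_space_distr) (rule rv)
  interpret D: product_sigma_finite "\<lambda>i. distr M borel (X i)" ..
  have "distr M (\<Pi>\<^sub>M i\<in>UNIV. borel) (\<lambda>\<omega>. \<lambda>i\<in>UNIV. X i \<omega>) = (\<Pi>\<^sub>M i\<in>UNIV. distr M borel (X i))"
    using indep_vars_iff_distr_eq_PiM[THEN iffD1, OF _ rv ind] by simp
  also have "\<dots> = density (\<Pi>\<^sub>M i\<in>UNIV. lborel) (\<lambda>f. ennreal (\<Prod>i\<in>UNIV. g i (f i)))"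
  proof (rule D.PiM_eqI[symmetric])
    show "sets (density (\<Pi>\<^sub>M i\<in>UNIV. lborel) (\<lambda>f. ennreal (\<Prod>i\<in>UNIV. g i (f i))))
        = sets (\<Pi>\<^sub>M i\<in>UNIV. distr M borel (X i))"
      unfolding sets_density by (intro sets_PiM_cong) auto
    fix A :: "'i \<Rightarrow> 'e set" assume A: "\<And>i. i \<in> UNIV \<Longrightarrow> A i \<in> sets (distr M borel (X i))"
    then have [measurable]: "A i \<in> sets borel" for i by simp
    have "emeasure (density (\<Pi>\<^sub>M i\<in>UNIV. lborel) (\<lambda>f. ennreal (\<Prod>i\<in>UNIV. g i (f i)))) (Pi\<^sub>E UNIV A)
        = (\<integral>\<^sup>+f. ennreal (\<Prod>i\<in>UNIV. g i (f i)) * indicator (Pi\<^sub>E UNIV A) f \<partial>(\<Pi>\<^sub>M i\<in>UNIV. lborel))"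
      by (intro emeasure_density) (auto intro!: sets_PiM_I_finite)
    also have "\<dots> = (\<integral>\<^sup>+f. (\<Prod>i\<in>UNIV. ennreal (g i (f i)) * indicator (A i) (f i)) \<partial>(\<Pi>\<^sub>M i\<in>UNIV. lborel))"
    proof (intro nn_integral_cong)
      fix f
      have "indicator (Pi\<^sub>E UNIV A) f = (\<Prod>i\<in>UNIV. indicator (A i) (f i) :: ennreal)"
        by (auto simp: indicator_def PiE_iff)
      then show "ennreal (\<Prod>i\<in>UNIV. g i (f i)) * indicator (Pi\<^sub>E UNIV A) f
          = (\<Prod>i\<in>UNIV. ennreal (g i (f i)) * indicator (A i) (f i))"
        by (simp add: prod.distrib prod_ennreal g)
    qed
    also have "\<dots> = (\<Prod>i\<in>UNIV. emeasure (distr M borel (X i)) (A i))"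
      by (subst L.product_nn_integral_prod) (auto simp: d emeasure_density)
    finally show "emeasure (density (\<Pi>\<^sub>M i\<in>UNIV. lborel) (\<lambda>f. ennreal (\<Prod>i\<in>UNIV. g i (f i)))) (Pi\<^sub>E UNIV A)
        = (\<Prod>i\<in>UNIV. emeasure (distr M borel (X i)) (A i))" .
  qed simp
  finally show ?thesis .
qed

text \<open>The noise entries are assembled into one Euclidean random variable: the product density
  depends on the family of entries only through the matrix they form, so it passes through the
  pushforward along \<open>?\<Phi>\<close>.\<close>

lemma (in prob_space) distributed_cn_matrix:
  fixes W :: "'a \<Rightarrow> complex^'r::finite^'n::finite"
  assumes s: "0 < s"
    and ind: "indep_vars (\<lambda>_. borel) (\<lambda>(a, r) \<omega>. W \<omega> $ a $ r) UNIV"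
    and W: "\<And>a r. distributed M lborel (\<lambda>\<omega>. W \<omega> $ a $ r) (\<lambda>z. ennreal (cn_density s z))"
  shows "distributed M lborel W (isotropic_density (s / 2))"
proof -
  let ?\<Phi> = "\<lambda>f. (\<chi> a r. f (a, r)) :: complex^'r^'n"
  have m: "(\<lambda>\<omega>. W \<omega> $ a $ r) \<in> borel_measurable M" for a r
    using distributed_measurable[OF W] by simp
  have [measurable]: "W \<in> borel_measurable M"
    by (subst borel_measurable_euclidean_space)
       (auto simp: Basis_vec_def inner_axis intro!: borel_measurable_inner m)
  have Phi[measurable]: "?\<Phi> \<in> borel_measurable (\<Pi>\<^sub>M p\<in>UNIV. borel)"
    by (subst borel_measurable_euclidean_space) (auto simp: Basis_vec_def inner_axis)
  have Phi': "?\<Phi> \<in> borel_measurable (\<Pi>\<^sub>M p\<in>UNIV. lborel)"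
    by (subst borel_measurable_euclidean_space) (auto simp: Basis_vec_def inner_axis)
  have pm: "(\<lambda>\<omega>. \<lambda>p\<in>UNIV. case p of (a, r) \<Rightarrow> W \<omega> $ a $ r) \<in> measurable M (\<Pi>\<^sub>M p\<in>UNIV. borel)"
    by (rule measurable_restrict) (auto simp: m split: prod.split)
  have "distr M lborel W = distr (distr M (\<Pi>\<^sub>M p\<in>UNIV. borel) (\<lambda>\<omega>. \<lambda>p\<in>UNIV. (case p of (a, r) \<Rightarrow> W \<omega> $ a $ r))) borel ?\<Phi>"
    by (subst distr_distr) (auto simp: comp_def pm vec_lambda_eta intro!: distr_cong)
  also have "distr M (\<Pi>\<^sub>M p\<in>UNIV. borel) (\<lambda>\<omega>. \<lambda>p\<in>UNIV. (case p of (a, r) \<Rightarrow> W \<omega> $ a $ r))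
      = density (\<Pi>\<^sub>M p\<in>UNIV. lborel) (\<lambda>f. ennreal (\<Prod>p\<in>UNIV. cn_density s (f p)))"
  proof -
    have "(\<lambda>\<omega>. \<lambda>p\<in>UNIV. (case p of (a, r) \<Rightarrow> W \<omega> $ a $ r))
       = (\<lambda>\<omega>. \<lambda>p\<in>UNIV. (case p of (a, r) \<Rightarrow> (\<lambda>\<omega>. W \<omega> $ a $ r)) \<omega>)"
      by (simp add: case_prod_unfold)
    with distributed_PiM_density[OF ind, of "\<lambda>_. cn_density s"] W s show ?thesis
      by (simp add: cn_density_def split: prod.split)
  qed
  also have "\<dots> = density (\<Pi>\<^sub>M p\<in>UNIV. lborel) (\<lambda>f. ennreal (isotropic_density (s / 2) (?\<Phi> f)))"
    using s by (simp add: isotropic_density_matrix cn_density_eq_isotropic case_prod_unfold)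
  also have "distr \<dots> borel ?\<Phi> = density (distr (\<Pi>\<^sub>M p\<in>UNIV. lborel) borel ?\<Phi>) (isotropic_density (s / 2))"
    by (subst density_distr) (auto intro: Phi')
  also have "\<dots> = density lborel (isotropic_density (s / 2))"
    by (simp add: lborel_matrix)
  finally show ?thesis
    unfolding distributed_def by auto
qed

section \<open>Characteristic functions and log densities of Gaussian variables\<close>

lemma integral_isotropic_density_iexp:
  fixes t :: "'e::euclidean_space"
  assumes v: "0 < v"
  shows "(CLINT w|density lborel (isotropic_density v). iexp (t \<bullet> w)) = complex_of_real (exp (- (v * (norm t)\<^sup>2) / 2))"
proof -
  interpret L: product_sigma_finite "\<lambda>_::'e. lborel :: real measure" ..
  define g where "g b x = normal_density 0 (sqrt v) x *\<^sub>R iexp ((b \<bullet> t) * x)" for b x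
  have gi: "complex_integrable lborel (g b)" for b
    unfolding g_def using v by (intro integrable_normal_density_iexp) auto
  have "(CLINT w|density lborel (isotropic_density v). iexp (t \<bullet> w))
      = (CLINT w|lborel. isotropic_density v w *\<^sub>R iexp (t \<bullet> w))"
    using v by (intro integral_density) (auto simp: isotropic_density_pos less_imp_le)
  also have "\<dots> = (CLINT w|lborel. (\<Prod>b\<in>Basis. g b (b \<bullet> w)))"
  proof (intro Bochner_Integration.integral_cong refl)
    fix w :: 'e
    have "iexp (t \<bullet> w) = (\<Prod>b\<in>Basis. iexp ((b \<bullet> t) * (b \<bullet> w)))"
      by (subst euclidean_inner) (simp only: of_real_sum sum_distrib_left exp_sum finite_Basis inner_commute)
    then show "isotropic_density v w *\<^sub>R iexp (t \<bullet> w) = (\<Prod>b\<in>Basis. g b (b \<bullet> w))"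
      by (simp add: isotropic_density_Basis v g_def scaleR_conv_of_real prod.distrib)
  qed
  also have "\<dots> = (CLINT f|(\<Pi>\<^sub>M b\<in>Basis. lborel). (\<Prod>b\<in>Basis. g b (f b)))"
  proof -
    have [measurable]: "g b \<in> borel_measurable borel" for b unfolding g_def by measurable
    have "(\<Prod>b\<in>Basis. g b (b \<bullet> (\<Sum>c\<in>Basis. f c *\<^sub>R c))) = (\<Prod>b\<in>Basis. g b (f b))" for f :: "'e \<Rightarrow> real"
      by (intro prod.cong refl) (simp add: inner_sum_right inner_Basis if_distrib cong: if_cong)
    then show ?thesis
      by (subst lborel_eq, subst integral_distr) simp_all
  qed
  also have "\<dots> = (\<Prod>b\<in>Basis. (CLINT x|lborel. g b x))"
    by (rule L.product_integral_prod) (use gi in auto)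
  also have "\<dots> = (\<Prod>b\<in>Basis. complex_of_real (exp (- (sqrt v * (b \<bullet> t))\<^sup>2 / 2)))"
    unfolding g_def using v by (intro prod.cong refl integral_normal_density_iexp) auto
  also have "\<dots> = complex_of_real (exp (\<Sum>b\<in>Basis. - (sqrt v * (b \<bullet> t))\<^sup>2 / 2))"
    by (simp add: exp_sum)
  also have "(\<Sum>b\<in>Basis. - (sqrt v * (b \<bullet> t))\<^sup>2 / 2) = - (v * (norm t)\<^sup>2) / 2"
    using v by (simp add: norm_power2_Basis[of t] power_mult_distrib sum_distrib_left sum_negf sum_divide_distrib)
  finally show ?thesis .
qed

text \<open>One-dimensional Levy uniqueness; it identifies the law of a single coordinate of the
  noise or of the echo.\<close>

lemma (in prob_space) distributed_normal_char:
  assumes [measurable]: "random_variable borel Z" and s: "0 < s"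
    and ch: "\<And>t. (CLINT \<omega>|M. iexp (t * Z \<omega>)) = complex_of_real (exp (- (s * t\<^sup>2) / 2))"
  shows "distributed M lborel Z (normal_density 0 (sqrt s))"
proof -
  have "distr M borel Z = density lborel (normal_density 0 (sqrt s))"
  proof (rule Levy_uniqueness)
    show "real_distribution (distr M borel Z)" by simp
    show "real_distribution (density lborel (normal_density 0 (sqrt s)))"
      using prob_space_normal_density[of "sqrt s" 0] s
      by (auto simp: real_distribution_def real_distribution_axioms_def)
    show "char (distr M borel Z) = char (density lborel (normal_density 0 (sqrt s)))"
    proof
      fix t
      have "char (density lborel (normal_density 0 (sqrt s))) t
          = (CLINT x|lborel. normal_density 0 (sqrt s) x *\<^sub>R iexp (t * x))"
        unfolding char_def by (subst integral_density) simp_all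
      also have "\<dots> = complex_of_real (exp (- (s * t\<^sup>2) / 2))"
        using s by (subst integral_normal_density_iexp) (auto simp: power_mult_distrib)
      finally show "char (distr M borel Z) t = char (density lborel (normal_density 0 (sqrt s))) t"
        using ch[of t] by (simp add: char_def integral_distr)
    qed
  qed
  then show ?thesis
    by (simp add: distributed_def cong: distr_cong)
qed

text \<open>The log density is affine in \<open>x\<^sup>2\<close>, so a finite second moment gives
  integrability; its mean is minus the differential entropy of the normal law.\<close>

lemma (in information_space) expectation_log_normal_density:
  assumes s: "0 < s" and Z: "distributed M lborel Z (normal_density 0 s)"
  shows "integrable M (\<lambda>\<omega>. log b (normal_density 0 s (Z \<omega>)))"
    and "expectation (\<lambda>\<omega>. log b (normal_density 0 s (Z \<omega>))) = - log b (2 * pi * exp 1 * s\<^sup>2) / 2"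
proof -
  have ln: "log b (normal_density 0 s x) = log b (1 / sqrt (2 * pi * s\<^sup>2)) + (- 1 / (2 * s\<^sup>2 * ln b)) * x\<^sup>2" for x
    using s b_gt_1 by (simp add: normal_density_def log_def ln_mult ln_div field_simps)
  have "integrable lborel (\<lambda>x. normal_density 0 s x * log b (normal_density 0 s x))"
    unfolding ln distrib_left
    using integrable_normal_moment[OF s, of 0 2] integrable_normal_density[OF s, of 0]
    by (simp add: mult.left_commute)
  then show "integrable M (\<lambda>\<omega>. log b (normal_density 0 s (Z \<omega>)))"
    by (subst (asm) distributed_integrable[OF Z]) auto
  have "expectation (\<lambda>\<omega>. log b (normal_density 0 s (Z \<omega>))) = - entropy b lborel Z"
    by (subst entropy_distr[OF Z]) (auto simp: distributed_integral[OF Z])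
  then show "expectation (\<lambda>\<omega>. log b (normal_density 0 s (Z \<omega>))) = - log b (2 * pi * exp 1 * s\<^sup>2) / 2"
    using entropy_normal_density[OF s Z] by simp
qed

text \<open>Rectangles determine a product of probability measures. The product form makes Fubini
  available for the pair of channel and noise, whose types differ.\<close>

lemma (in prob_space) distr_pair_indep_rv:
  assumes ind: "indep_rv M S X T Y"
  shows "distr M (S \<Otimes>\<^sub>M T) (\<lambda>\<omega>. (X \<omega>, Y \<omega>)) = distr M S X \<Otimes>\<^sub>M distr M T Y"
proof -
  have [measurable]: "X \<in> measurable M S" "Y \<in> measurable M T"
    and I: "indep_set (sigma_sets (space M) {X -` A \<inter> space M |A. A \<in> sets S})
       (sigma_sets (space M) {Y -` A \<inter> space M |A. A \<in> sets T})"
    using ind by (auto simp: indep_rv_def)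
  interpret X: prob_space "distr M S X" by (rule prob_space_distr) simp
  interpret Y: prob_space "distr M T Y" by (rule prob_space_distr) simp
  show ?thesis
  proof (rule pair_measure_eqI[symmetric])
    show "sigma_finite_measure (distr M S X)" "sigma_finite_measure (distr M T Y)" ..
    show "sets (distr M S X \<Otimes>\<^sub>M distr M T Y) = sets (distr M (S \<Otimes>\<^sub>M T) (\<lambda>\<omega>. (X \<omega>, Y \<omega>)))"
      by (simp cong: sets_pair_measure_cong)
    fix A B assume "A \<in> sets (distr M S X)" "B \<in> sets (distr M T Y)"
    then have [measurable]: "A \<in> sets S" "B \<in> sets T" by auto
    have "prob ((X -` A \<inter> space M) \<inter> (Y -` B \<inter> space M)) = prob (X -` A \<inter> space M) * prob (Y -` B \<inter> space M)"
      by (rule indep_setD[OF I]) (auto intro!: sigma_sets.Basic)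
    moreover have "(\<lambda>\<omega>. (X \<omega>, Y \<omega>)) -` (A \<times> B) \<inter> space M = (X -` A \<inter> space M) \<inter> (Y -` B \<inter> space M)"
      by auto
    ultimately show "emeasure (distr M S X) A * emeasure (distr M T Y) B
        = emeasure (distr M (S \<Otimes>\<^sub>M T) (\<lambda>\<omega>. (X \<omega>, Y \<omega>))) (A \<times> B)"
      by (simp add: emeasure_distr emeasure_eq_measure ennreal_mult)
  qed
qed

subsection \<open>The additive Gaussian noise channel\<close>

text \<open>A preimage under a function of \<open>X\<close> is a preimage under \<open>X\<close>, so
  the generated sigma-algebras can only shrink.\<close>

lemma (in prob_space) indep_rv_compose:
  assumes ind: "indep_rv M S X T Y" and f: "f \<in> measurable S S'" and g: "g \<in> measurable T T'"
  shows "indep_rv M S' (\<lambda>\<omega>. f (X \<omega>)) T' (\<lambda>\<omega>. g (Y \<omega>))"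
proof -
  have X: "X \<in> measurable M S" and Y: "Y \<in> measurable M T"
    and I: "indep_set (sigma_sets (space M) {X -` A \<inter> space M |A. A \<in> sets S})
       (sigma_sets (space M) {Y -` A \<inter> space M |A. A \<in> sets T})"
    using ind by (auto simp: indep_rv_def)
  have sub: "sigma_sets (space M) {(\<lambda>\<omega>. h (Z \<omega>)) -` A \<inter> space M |A. A \<in> sets K'}
      \<subseteq> sigma_sets (space M) {Z -` A \<inter> space M |A. A \<in> sets K}"
    if Z: "Z \<in> measurable M K" and h: "h \<in> measurable K K'" for h Z and K :: "'x measure" and K' :: "'y measure"
  proof (rule sigma_sets_mono', safe)
    fix A assume A: "A \<in> sets K'"
    have "(\<lambda>\<omega>. h (Z \<omega>)) -` A \<inter> space M = Z -` (h -` A \<inter> space K) \<inter> space M"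
      using measurable_space[OF Z] by auto
    then show "\<exists>B. (\<lambda>\<omega>. h (Z \<omega>)) -` A \<inter> space M = Z -` B \<inter> space M \<and> B \<in> sets K"
      using measurable_sets[OF h A] by blast
  qed
  have "indep_set (sigma_sets (space M) {(\<lambda>\<omega>. f (X \<omega>)) -` A \<inter> space M |A. A \<in> sets S'})
       (sigma_sets (space M) {(\<lambda>\<omega>. g (Y \<omega>)) -` A \<inter> space M |A. A \<in> sets T'})"
    using I unfolding indep_set_def
    by (rule indep_sets_mono_sets) (auto split: bool.split intro: subsetD[OF sub[OF X f]] subsetD[OF sub[OF Y g]])
  then show ?thesis
    using measurable_compose[OF X f] measurable_compose[OF Y g] by (simp add: indep_rv_def)
qed

text \<open>The logarithm turns the product into a sum and expectation is linear, so the marginal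
  laws of the coordinates suffice and their joint law never enters.\<close>

lemma (in information_space) expectation_log_prod_normal_density:
  assumes fin: "finite I" and s: "\<And>j. j \<in> I \<Longrightarrow> 0 < s j"
    and Z: "\<And>j. j \<in> I \<Longrightarrow> distributed M lborel (\<lambda>\<omega>. e j \<bullet> Z \<omega>) (normal_density 0 (sqrt (s j)))"
  shows "integrable M (\<lambda>\<omega>. log b (\<Prod>j\<in>I. normal_density 0 (sqrt (s j)) (e j \<bullet> Z \<omega>)))" (is ?int)
    and "expectation (\<lambda>\<omega>. log b (\<Prod>j\<in>I. normal_density 0 (sqrt (s j)) (e j \<bullet> Z \<omega>)))
      = (\<Sum>j\<in>I. - log b (2 * pi * exp 1 * s j) / 2)" (is ?eq)
proof -
  have l: "log b (\<Prod>j\<in>I. normal_density 0 (sqrt (s j)) (e j \<bullet> Z \<omega>))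
      = (\<Sum>j\<in>I. log b (normal_density 0 (sqrt (s j)) (e j \<bullet> Z \<omega>)))" for \<omega>
    using fin s unfolding log_def
    by (subst ln_prod) (auto simp: normal_density_pos less_imp_neq[symmetric] sum_divide_distrib)
  show ?int ?eq
    unfolding l using s Z
    by (auto simp: expectation_log_normal_density less_imp_le intro!: sum.cong)
qed

text \<open>The vectors \<open>e j\<close> serve as real orthonormal coordinates, and
  \<open>l j\<close> is the variance of the signal \<open>T (G \<omega>)\<close> along
  \<open>e j\<close>, possibly 0. A real normal variable of variance \<open>s\<close> has entropy
  half of log(2 pi e s), whence the factor 1/2 in the second conclusion.\<close>

theorem (in information_space)
  fixes W Y :: "'a \<Rightarrow> 'e::euclidean_space" and G :: "'a \<Rightarrow> 'g::topological_space"
  assumes ind: "indep_rv M borel G borel W" and v: "0 < v"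
    and W: "distributed M lborel W (isotropic_density v)"
    and T[measurable]: "T \<in> borel_measurable borel"
    and Y: "\<And>\<omega>. \<omega> \<in> space M \<Longrightarrow> Y \<omega> = T (G \<omega>) + W \<omega>"
    and fin: "finite I" and card: "card I = DIM('e)"
    and norm: "\<And>w. (norm w)\<^sup>2 = (\<Sum>j\<in>I. (e j \<bullet> w)\<^sup>2)"
    and norm1: "\<And>j. j \<in> I \<Longrightarrow> norm (e j) = 1"
    and l: "\<And>j. j \<in> I \<Longrightarrow> 0 \<le> l j"
    and ch: "\<And>\<tau>. (CLINT \<omega>|M. iexp (\<Sum>j\<in>I. \<tau> j * (e j \<bullet> T (G \<omega>))))
        = complex_of_real (exp (- (\<Sum>j\<in>I. l j * (\<tau> j)\<^sup>2) / 2))"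
  shows mutual_information_gaussian_channel_entropy:
      "mutual_information b borel borel G Y = entropy b lborel Y - entropy b lborel W"
    and mutual_information_gaussian_channel:
      "mutual_information b borel borel G Y = (\<Sum>j\<in>I. log b ((l j + v) / v)) / 2"
proof -
  have G[measurable]: "G \<in> borel_measurable M" and W'[measurable]: "W \<in> borel_measurable M"
    using ind by (auto simp: indep_rv_def)
  have Ym[measurable]: "Y \<in> borel_measurable M"
    using Y by (subst measurable_cong[where g = "\<lambda>\<omega>. T (G \<omega>) + W \<omega>"]) auto
  define P where "P = distr M borel G"
  have sP[measurable_cong]: "sets P = sets borel" and spP: "space P = UNIV" by (auto simp: P_def)
  interpret P: prob_space P unfolding P_def by (rule prob_space_distr) simp
  interpret PL: pair_sigma_finite P "lborel :: 'e measure" ..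
  define fW where "fW = (isotropic_density v :: 'e \<Rightarrow> real)"
  define fY where "fY y = (\<Prod>j\<in>I. normal_density 0 (sqrt (l j + v)) (e j \<bullet> y))" for y
  have [measurable]: "fW \<in> borel_measurable borel" "fY \<in> borel_measurable borel"
    unfolding fW_def fY_def by measurable
  have lv: "0 < l j + v" if "j \<in> I" for j using l[OF that] v by simp
  have fW_pos: "0 < fW y" for y using v by (simp add: fW_def isotropic_density_pos)
  have fY_pos: "0 < fY y" for y unfolding fY_def using lv by (intro prod_pos) (auto simp: normal_density_pos)
  have fW_prod: "fW y = (\<Prod>j\<in>I. normal_density 0 (sqrt v) (e j \<bullet> y))" for y
    unfolding fW_def by (rule isotropic_density_eq_prod[OF fin card v norm])
  \<comment> \<open>This is the value at the origin, the maximum; the uniform bound makes every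
    translate integrable over the law of \<open>G\<close>.\<close>
  have fW_le: "fW y \<le> 1 / sqrt (2 * pi * v) ^ DIM('e)" for y
    using v by (auto simp: fW_def isotropic_density_def intro!: divide_right_mono)
  note distributed_distr_eq_density[OF W, folded fW_def]
  then have dW: "distr M borel W = density lborel fW" by (simp cong: distr_cong)

  have smooth: "(\<integral>\<^sup>+g. ennreal (fW (y - T g)) \<partial>P) = ennreal (fY y)" for y
  proof -
    have "integrable P (\<lambda>g. fW (y - T g))"
      by (rule P.integrable_const_bound[where B = "1 / sqrt (2 * pi * v) ^ DIM('e)"])
         (use fW_le in \<open>auto simp: abs_of_pos[OF fW_pos]\<close>)
    then have "(\<integral>\<^sup>+g. ennreal (fW (y - T g)) \<partial>P) = ennreal (LINT g|P. fW (y - T g))"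
      using fW_pos by (intro nn_integral_eq_integral) (auto intro: less_imp_le)
    also have "(LINT g|P. fW (y - T g)) = (LINT h|distr M borel (\<lambda>\<omega>. T (G \<omega>)). fW (y - h))"
      by (simp add: P_def integral_distr)
    also have "\<dots> = fY y"
      unfolding fW_prod fY_def
    proof (rule gaussian_smoothing)
      show "prob_space (distr M borel (\<lambda>\<omega>. T (G \<omega>)))" by (rule prob_space_distr) simp
      show "(CLINT h|distr M borel (\<lambda>\<omega>. T (G \<omega>)). iexp (\<Sum>j\<in>I. \<tau> j * (e j \<bullet> h)))
        = complex_of_real (exp (- (\<Sum>j\<in>I. l j * (\<tau> j)\<^sup>2) / 2))" for \<tau>
        using ch[of \<tau>] by (subst integral_distr) auto
    qed (use fin v l in auto)
    finally show ?thesis .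
  qed

  \<comment> \<open>\<open>G\<close> need not have a Lebesgue density, so its own law \<open>P\<close> serves as the reference measure.\<close>
  have joint: "emeasure (distr M (P \<Otimes>\<^sub>M lborel) (\<lambda>\<omega>. (G \<omega>, Y \<omega>))) A
      = (\<integral>\<^sup>+g. \<integral>\<^sup>+y. ennreal (fW (y - T g)) * indicator A (g, y) \<partial>lborel \<partial>P)"
    if "A \<in> sets (P \<Otimes>\<^sub>M lborel)" for A
  proof -
    have A[measurable]: "A \<in> sets (borel \<Otimes>\<^sub>M borel)"
      using that by (simp cong: sets_pair_measure_cong add: sP)
    have "emeasure (distr M (P \<Otimes>\<^sub>M lborel) (\<lambda>\<omega>. (G \<omega>, Y \<omega>))) A = (\<integral>\<^sup>+\<omega>. indicator A (G \<omega>, Y \<omega>) \<partial>M)"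
      using that by (subst nn_integral_indicator[symmetric], simp, subst nn_integral_distr) auto
    also have "\<dots> = (\<integral>\<^sup>+\<omega>. indicator A (G \<omega>, T (G \<omega>) + W \<omega>) \<partial>M)"
      by (intro nn_integral_cong) (simp add: Y)
    also have "\<dots> = (\<integral>\<^sup>+p. indicator A (fst p, T (fst p) + snd p) \<partial>distr M (borel \<Otimes>\<^sub>M borel) (\<lambda>\<omega>. (G \<omega>, W \<omega>)))"
      by (subst nn_integral_distr) auto
    also have "\<dots> = (\<integral>\<^sup>+p. indicator A (fst p, T (fst p) + snd p) \<partial>(P \<Otimes>\<^sub>M density lborel fW))"
      unfolding distr_pair_indep_rv[OF ind] dW P_def ..
    also have "\<dots> = (\<integral>\<^sup>+g. \<integral>\<^sup>+w. indicator A (g, T g + w) \<partial>density lborel fW \<partial>P)"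
    proof -
      interpret D: prob_space "density lborel fW"
        unfolding dW[symmetric] by (rule prob_space_distr) simp
      show ?thesis by (subst D.nn_integral_fst[symmetric]) auto
    qed
    also have "\<dots> = (\<integral>\<^sup>+g. \<integral>\<^sup>+y. ennreal (fW (y - T g)) * indicator A (g, y) \<partial>lborel \<partial>P)"
    proof (intro nn_integral_cong)
      fix g
      have "(\<integral>\<^sup>+w. indicator A (g, T g + w) \<partial>density lborel fW)
          = (\<integral>\<^sup>+w. ennreal (fW ((T g + w) - T g)) * indicator A (g, T g + w) \<partial>lborel)"
        by (subst nn_integral_density) auto
      \<comment> \<open>Substitution of \<open>y = T g + w\<close>; translation invariance of
        \<open>lborel\<close> then removes the pushforward.\<close>
      also have "\<dots> = (\<integral>\<^sup>+y. ennreal (fW (y - T g)) * indicator A (g, y) \<partial>distr lborel borel ((+) (T g)))"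
        by (subst nn_integral_distr) auto
      finally show "(\<integral>\<^sup>+w. indicator A (g, T g + w) \<partial>density lborel fW)
          = (\<integral>\<^sup>+y. ennreal (fW (y - T g)) * indicator A (g, y) \<partial>lborel)"
        by (simp add: lborel_distr_plus)
    qed
    finally show ?thesis .
  qed

  \<comment> \<open>Relative to its own law, \<open>G\<close> has constant density 1, whatever its
    distribution.\<close>
  have DG: "distributed M P G (\<lambda>_. ennreal 1)"
    by (auto simp: distributed_def density_1 P_def cong: distr_cong)
  have DY: "distributed M lborel Y fY"
  proof -
    have "distr M lborel Y = density lborel fY"
    proof (rule measure_eqI)
      fix A assume "A \<in> sets (distr M lborel Y)"
      then have [measurable]: "A \<in> sets borel" by simp
      have "emeasure (distr M lborel Y) A = emeasure (distr M (P \<Otimes>\<^sub>M lborel) (\<lambda>\<omega>. (G \<omega>, Y \<omega>))) (UNIV \<times> A)"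
        by (subst (1 2) emeasure_distr) (auto simp: spP intro!: arg_cong[where f = "emeasure M"])
      also have "\<dots> = (\<integral>\<^sup>+g. \<integral>\<^sup>+y. ennreal (fW (y - T g)) * indicator (UNIV \<times> A) (g, y) \<partial>lborel \<partial>P)"
        by (rule joint) (auto simp: sP)
      \<comment> \<open>Integrating over \<open>g\<close> first averages the translates of the noise
        density, which \<open>smooth\<close> evaluates.\<close>
      also have "\<dots> = (\<integral>\<^sup>+y. \<integral>\<^sup>+g. ennreal (fW (y - T g)) * indicator (UNIV \<times> A) (g, y) \<partial>P \<partial>lborel)"
        by (rule PL.Fubini'[symmetric]) simp
      also have "\<dots> = (\<integral>\<^sup>+y. ennreal (fY y) * indicator A y \<partial>lborel)"
        by (simp add: nn_integral_multc smooth indicator_times)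
      finally show "emeasure (distr M lborel Y) A = emeasure (density lborel fY) A"
        by (simp add: emeasure_density)
    qed simp
    then show ?thesis by (simp add: distributed_def)
  qed
  define fGY where "fGY = (\<lambda>(g, y). fW (y - T g))"
  have [measurable]: "fGY \<in> borel_measurable (P \<Otimes>\<^sub>M lborel)"
    unfolding fGY_def by measurable
  have DGY: "distributed M (P \<Otimes>\<^sub>M lborel) (\<lambda>\<omega>. (G \<omega>, Y \<omega>)) fGY"
  proof -
    have "distr M (P \<Otimes>\<^sub>M lborel) (\<lambda>\<omega>. (G \<omega>, Y \<omega>)) = density (P \<Otimes>\<^sub>M lborel) fGY"
    proof (rule measure_eqI)
      fix A assume "A \<in> sets (distr M (P \<Otimes>\<^sub>M lborel) (\<lambda>\<omega>. (G \<omega>, Y \<omega>)))"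
      then have A[measurable]: "A \<in> sets (P \<Otimes>\<^sub>M lborel)" by simp
      have "emeasure (density (P \<Otimes>\<^sub>M lborel) fGY) A = (\<integral>\<^sup>+p. ennreal (fGY p) * indicator A p \<partial>(P \<Otimes>\<^sub>M lborel))"
        by (rule emeasure_density[OF _ A]) simp
      also have "\<dots> = (\<integral>\<^sup>+g. \<integral>\<^sup>+y. ennreal (fGY (g, y)) * indicator A (g, y) \<partial>lborel \<partial>P)"
        by (rule lborel.nn_integral_fst[symmetric]) simp
      finally show "emeasure (distr M (P \<Otimes>\<^sub>M lborel) (\<lambda>\<omega>. (G \<omega>, Y \<omega>))) A = emeasure (density (P \<Otimes>\<^sub>M lborel) fGY) A"
        by (simp add: joint[OF A] fGY_def)
    qed simp
    then show ?thesis by (auto simp: distributed_def)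
  qed

  have chW: "(CLINT \<omega>|M. iexp (t * (e j \<bullet> W \<omega>))) = complex_of_real (exp (- (v * t\<^sup>2) / 2))"
    if j: "j \<in> I" for j t
  proof -
    have "(CLINT \<omega>|M. iexp (t * (e j \<bullet> W \<omega>))) = (CLINT w|density lborel (isotropic_density v). iexp ((t *\<^sub>R e j) \<bullet> w))"
      unfolding dW[symmetric, unfolded fW_def] by (subst integral_distr) auto
    also have "\<dots> = complex_of_real (exp (- (v * t\<^sup>2) / 2))"
      by (simp only: integral_isotropic_density_iexp[OF v] norm_scaleR norm1[OF j]) simp
    finally show ?thesis .
  qed
  have jY: "distributed M lborel (\<lambda>\<omega>. e j \<bullet> Y \<omega>) (normal_density 0 (sqrt (l j + v)))" if j: "j \<in> I" for j
  proof (rule distributed_normal_char)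
    fix t
    have i: "indep_var borel (\<lambda>\<omega>. e j \<bullet> T (G \<omega>)) borel (\<lambda>\<omega>. e j \<bullet> W \<omega>)"
      unfolding indep_rv_iff_indep_var[symmetric] by (rule indep_rv_compose[OF ind]) auto
    have "(CLINT \<omega>|M. iexp (t * (e j \<bullet> Y \<omega>))) = char (distr M borel (\<lambda>\<omega>. e j \<bullet> T (G \<omega>) + e j \<bullet> W \<omega>)) t"
      unfolding char_def by (subst integral_distr) (auto simp: Y inner_add_right intro!: Bochner_Integration.integral_cong)
    also have "\<dots> = (CLINT \<omega>|M. iexp (t * (e j \<bullet> T (G \<omega>)))) * (CLINT \<omega>|M. iexp (t * (e j \<bullet> W \<omega>)))"
      unfolding char_distr_add[OF i] by (simp add: char_def integral_distr)
    \<comment> \<open>A frequency vector supported at \<open>j\<close> reduces the joint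
      characteristic function to that of one coordinate.\<close>
    also have "(CLINT \<omega>|M. iexp (t * (e j \<bullet> T (G \<omega>)))) = complex_of_real (exp (- (l j * t\<^sup>2) / 2))"
      using ch[of "\<lambda>i. if i = j then t else 0"] fin j
      by (simp add: if_distrib if_distribR cong: if_cong)
    also have "(CLINT \<omega>|M. iexp (t * (e j \<bullet> W \<omega>))) = complex_of_real (exp (- (v * t\<^sup>2) / 2))"
      by (rule chW[OF j])
    finally show "(CLINT \<omega>|M. iexp (t * (e j \<bullet> Y \<omega>))) = complex_of_real (exp (- ((l j + v) * t\<^sup>2) / 2))"
      by (simp add: exp_add[symmetric] of_real_mult[symmetric] algebra_simps add_divide_distrib diff_divide_distrib
          del: of_real_mult of_real_exp)
  qed (use lv[OF j] in auto)
  have jW: "distributed M lborel (\<lambda>\<omega>. e j \<bullet> W \<omega>) (normal_density 0 (sqrt v))" if j: "j \<in> I" for j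
    by (rule distributed_normal_char[OF _ v chW[OF j]]) simp
  have EY: "integrable M (\<lambda>\<omega>. log b (fY (Y \<omega>)))"
    "expectation (\<lambda>\<omega>. log b (fY (Y \<omega>))) = (\<Sum>j\<in>I. - log b (2 * pi * exp 1 * (l j + v)) / 2)"
    unfolding fY_def
    by (rule expectation_log_prod_normal_density[where s = "\<lambda>j. l j + v", OF fin lv jY], assumption+)+
  have EW: "integrable M (\<lambda>\<omega>. log b (fW (W \<omega>)))"
    "expectation (\<lambda>\<omega>. log b (fW (W \<omega>))) = (\<Sum>j\<in>I. - log b (2 * pi * exp 1 * v) / 2)"
    unfolding fW_prod
    by (rule expectation_log_prod_normal_density[where s = "\<lambda>_. v", OF fin v jW], assumption)+
  have hY: "entropy b lborel Y = - expectation (\<lambda>\<omega>. log b (fY (Y \<omega>)))"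
    using fY_pos by (subst entropy_distr[OF DY]) (auto simp: distributed_integral[OF DY] less_imp_le)
  have hW: "entropy b lborel W = - expectation (\<lambda>\<omega>. log b (fW (W \<omega>)))"
    using fW_pos by (subst entropy_distr[OF W[folded fW_def]])
      (auto simp: distributed_integral[OF W[folded fW_def]] less_imp_le)
  \<comment> \<open>Mutual information sees only the sigma-algebras of its two reference spaces, so
    these may be replaced by \<open>P\<close> and \<open>lborel\<close>, relative to which densities
    exist.\<close>
  have "mutual_information b borel borel G Y = mutual_information b P lborel G Y"
    unfolding mutual_information_def
    by (intro arg_cong2[where f = "KL_divergence b"] arg_cong2[where f = pair_measure] distr_cong refl)
       (simp_all add: sP cong: sets_pair_measure_cong)
  also have "\<dots> = (\<integral>p. fGY p * log b (fGY p / (1 * fY (snd p))) \<partial>(P \<Otimes>\<^sub>M lborel))"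
    by (rule mutual_information_distr[OF _ _ DG _ DY _ DGY])
       (use fW_pos fY_pos in \<open>auto simp: fGY_def less_imp_le intro: P.sigma_finite_measure_axioms sigma_finite_lborel\<close>)
  also have "\<dots> = expectation (\<lambda>\<omega>. log b (fGY (G \<omega>, Y \<omega>) / fY (Y \<omega>)))"
    using fW_pos by (subst distributed_integral[OF DGY]) (auto simp: fGY_def less_imp_le)
  also have "\<dots> = expectation (\<lambda>\<omega>. log b (fW (W \<omega>)) - log b (fY (Y \<omega>)))"
    using less_imp_neq[OF fW_pos, symmetric] less_imp_neq[OF fY_pos, symmetric]
    by (intro Bochner_Integration.integral_cong refl) (auto simp: fGY_def Y log_divide)
  also have "\<dots> = expectation (\<lambda>\<omega>. log b (fW (W \<omega>))) - expectation (\<lambda>\<omega>. log b (fY (Y \<omega>)))"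
    by (intro Bochner_Integration.integral_diff EW(1) EY(1))
  finally have I: "mutual_information b borel borel G Y
      = expectation (\<lambda>\<omega>. log b (fW (W \<omega>))) - expectation (\<lambda>\<omega>. log b (fY (Y \<omega>)))" .
  then show "mutual_information b borel borel G Y = entropy b lborel Y - entropy b lborel W"
    by (simp add: hY hW)
  show "mutual_information b borel borel G Y = (\<Sum>j\<in>I. log b ((l j + v) / v)) / 2"
  proof -
    have "log b (2 * pi * exp 1 * x) = log b (2 * pi * exp 1) + log b x" if "0 < x" for x
      using that by (subst log_mult) auto
    moreover have "log b (x / v) = log b x - log b v" if "0 < x" for x
      using that v by (subst log_divide) auto
    ultimately show ?thesis
      unfolding I EY(2) EW(2) sum_subtractf[symmetric] sum_divide_distrib
      using v lv by (intro sum.cong refl) (simp add: diff_divide_distrib del: add_divide_distrib div_add_self2)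
  qed
qed

subsection \<open>Hermitian matrices\<close>

text \<open>The Rayleigh quotient attains its maximum \<open>c\<close> on the compact unit sphere of
  \<open>S\<close>, and a maximizer is an eigenvector. Working inside an invariant subspace permits
  deflation, and working over the reals makes the eigenvalue real.\<close>

lemma selfadjoint_eigenvector:
  fixes f :: "'e::euclidean_space \<Rightarrow> 'e"
  assumes lin: "linear f" and sa: "\<And>x y. f x \<bullet> y = x \<bullet> f y"
    and S: "subspace S" and fS: "f ` S \<subseteq> S" and ne: "S \<noteq> {0}"
  obtains x c where "x \<in> S" "norm x = 1" "f x = c *\<^sub>R x"
proof -
  interpret f: linear f by fact
  let ?K = "S \<inter> sphere 0 1"
  have "compact ?K"
    using closed_subspace[OF S] by (intro closed_Int_compact) auto
  moreover have "?K \<noteq> {}"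
  proof -
    obtain y where y: "y \<in> S" "y \<noteq> 0"
      using ne subspace_0[OF S] by auto
    have "inverse (norm y) *\<^sub>R y \<in> ?K"
      using y subspace_scale[OF S] by simp
    then show ?thesis by blast
  qed
  moreover have "continuous_on ?K (\<lambda>x. x \<bullet> f x)"
    using linear_continuous_on[of f ?K] lin
    by (intro continuous_intros) (simp add: linear_conv_bounded_linear)
  ultimately obtain x where x: "x \<in> ?K" and max: "\<And>y. y \<in> ?K \<Longrightarrow> y \<bullet> f y \<le> x \<bullet> f x"
    using continuous_attains_sup[of ?K "\<lambda>x. x \<bullet> f x"] by blast
  define c where "c = x \<bullet> f x"
  have xS: "x \<in> S" and nx: "norm x = 1" using x by auto
  have xx: "x \<bullet> x = 1" using nx by (simp add: norm_eq_1)
  \<comment> \<open>\<open>B\<close> is positive semidefinite on \<open>S\<close> and \<open>B x x = 0\<close>, so \<open>x\<close> lies in its radical.\<close>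
  define B where "B y z = c * (y \<bullet> z) - y \<bullet> f z" for y z
  have Bsym: "B y z = B z y" for y z
    unfolding B_def by (metis inner_commute sa)
  have Bpos: "0 \<le> B y y" if "y \<in> S" for y
  proof (cases "y = 0")
    case False
    have "(inverse (norm y) *\<^sub>R y) \<bullet> f (inverse (norm y) *\<^sub>R y) \<le> c"
      unfolding c_def using that False subspace_scale[OF S] by (intro max) simp
    then have "(y \<bullet> f y) / (norm y)\<^sup>2 \<le> c"
      by (simp add: f.scaleR power2_eq_square divide_inverse mult_ac)
    then show ?thesis
      using False by (simp add: B_def divide_simps power2_norm_eq_inner)
  qed (simp add: B_def)
  have B0: "B x z = 0" if z: "z \<in> S" for z
  proof (rule ccontr)
    assume nz: "B x z \<noteq> 0"
    have Bxx: "B x x = 0" by (simp add: B_def c_def xx)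
    have expand: "B (x + t *\<^sub>R z) (x + t *\<^sub>R z) = 2 * t * B x z + t\<^sup>2 * B z z" for t
    proof -
      have "B (x + t *\<^sub>R z) (x + t *\<^sub>R z) = B x x + t * B x z + t * B z x + t\<^sup>2 * B z z"
        by (simp add: B_def f.add f.scaleR inner_add_left inner_add_right power2_eq_square algebra_simps)
      then show ?thesis by (simp add: Bsym[of z x] Bxx)
    qed
    have ge: "0 \<le> 2 * t * B x z + t\<^sup>2 * B z z" for t
      unfolding expand[symmetric] using xS z by (intro Bpos subspace_add[OF S] subspace_scale[OF S])
    have Bz: "0 \<le> B z z" by (rule Bpos[OF z])
    \<comment> \<open>The minimizer of the quadratic would be \<open>t = - B x z / B z z\<close>;
      the added 1 keeps the denominator positive when \<open>B z z = 0\<close> and still gives a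
      negative value.\<close>
    have "0 \<le> 2 * (- B x z / (1 + B z z)) * B x z + (- B x z / (1 + B z z))\<^sup>2 * B z z"
      by (rule ge)
    also have "\<dots> = - (B x z)\<^sup>2 * (2 + B z z) / (1 + B z z)\<^sup>2"
    proof -
      have "2 * (- p / d) * p + (- p / d)\<^sup>2 * (d - 1) = - p\<^sup>2 * (2 + (d - 1)) / d\<^sup>2" if "d \<noteq> 0" for p d :: real
        using that by (simp add: field_simps power2_eq_square)
      from this[of "1 + B z z" "B x z"] Bz show ?thesis by simp
    qed
    also have "\<dots> < 0"
      using Bz nz by (intro divide_neg_pos) (auto intro!: mult_pos_pos)
    finally show False by simp
  qed
  have "f x \<in> S" using fS xS by blast
  then have mem: "c *\<^sub>R x - f x \<in> S"
    by (intro subspace_diff[OF S] subspace_scale[OF S] xS)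
  \<comment> \<open>By self-adjointness \<open>B x z\<close> is the inner product of
    \<open>c *\<^sub>R x - f x\<close> with \<open>z\<close>; choosing \<open>z\<close> as that same
    vector turns \<open>B0\<close> into a vanishing squared norm.\<close>
  have "(c *\<^sub>R x - f x) \<bullet> (c *\<^sub>R x - f x) = B x (c *\<^sub>R x - f x)"
    by (simp add: B_def inner_diff_left sa)
  also have "\<dots> = 0" by (rule B0[OF mem])
  finally have "f x = c *\<^sub>R x" by simp
  with xS nx show ?thesis by (rule that)
qed

section \<open>The Hermitian inner product and the spectral theorem\<close>

text \<open>Conjugate-linear in the first argument. The inner product belonging to the type is only
  its real part.\<close>

definition cinner :: "complex^'n \<Rightarrow> complex^'n \<Rightarrow> complex" where
  "cinner x y = (\<Sum>k\<in>UNIV. cnj (x $ k) * y $ k)"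

lemma inner_eq_Re_cinner: "x \<bullet> y = Re (cinner x y)"
  by (simp add: cinner_def inner_vec_def inner_complex_def)

lemma inner_ii_eq_Im_cinner: "(\<i> *s x) \<bullet> y = Im (cinner x y)"
  by (simp add: cinner_def inner_vec_def inner_complex_def algebra_simps)

lemma cinner_commute: "cinner y x = cnj (cinner x y)"
  by (simp add: cinner_def mult.commute)

lemma cinner_self: "cinner x x = complex_of_real ((norm x)\<^sup>2)"
proof -
  have "Im (cinner x x) = 0"
    using cinner_commute[of x x] by (simp add: complex_eq_iff)
  then show ?thesis
    by (simp add: complex_eq_iff power2_norm_eq_inner inner_eq_Re_cinner)
qed

lemma cinner_add_right: "cinner x (y + z) = cinner x y + cinner x z"
  by (simp add: cinner_def algebra_simps sum.distrib)

lemma cinner_scale_right: "cinner x (c *s y) = c * cinner x y"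
  by (simp add: cinner_def algebra_simps sum_distrib_left)

lemma cinner_scale_left: "cinner (c *s x) y = cnj c * cinner x y"
  by (simp add: cinner_def algebra_simps sum_distrib_left)

lemma cinner_scaleR_right: "cinner x (c *\<^sub>R y) = c *\<^sub>R cinner x y"
  by (simp add: cinner_def scaleR_sum_right)

lemma cinner_sum_right: "cinner x (sum f A) = (\<Sum>i\<in>A. cinner x (f i))"
  by (induction A rule: infinite_finite_induct) (simp_all add: cinner_add_right, simp_all add: cinner_def)

lemma cinner_sum_left: "cinner (sum f A) x = (\<Sum>i\<in>A. cinner (f i) x)"
  unfolding cinner_commute[of "sum f A"] cinner_sum_right cnj_sum
  by (simp only: cinner_commute[symmetric])

lemma cinner_matrix_right: "cinner x (A *v y) = cinner (ctranspose A *v x) y"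
proof -
  have "cinner x (A *v y) = (\<Sum>k\<in>UNIV. \<Sum>i\<in>UNIV. cnj (x $ k) * (A $ k $ i * y $ i))"
    by (simp add: cinner_def matrix_vector_mult_def sum_distrib_left)
  also have "\<dots> = (\<Sum>i\<in>UNIV. \<Sum>k\<in>UNIV. cnj (x $ k) * (A $ k $ i * y $ i))"
    by (rule sum.swap)
  also have "\<dots> = cinner (ctranspose A *v x) y"
    by (simp add: cinner_def matrix_vector_mult_def ctranspose_def sum_distrib_left sum_distrib_right mult_ac)
  finally show ?thesis .
qed

lemma ctranspose_ctranspose [simp]: "ctranspose (ctranspose A) = A"
  by (simp add: ctranspose_def vec_eq_iff)

lemma ctranspose_mult: "ctranspose (A ** B) = ctranspose B ** ctranspose A"
  by (simp add: ctranspose_def matrix_matrix_mult_def vec_eq_iff mult.commute)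

text \<open>Deflation: the orthogonal complement of the eigenvectors found so far is invariant under
  \<open>K\<close> and supplies the next one. Induction over subsets of the index type lets the
  final basis be indexed by the matrix indices themselves.\<close>

lemma hermitian_orthonormal_eigenvectors:
  fixes K :: "complex^'n^'n" and A :: "'n set"
  assumes herm: "ctranspose K = K"
  shows "\<exists>u \<sigma>. (\<forall>i\<in>A. \<forall>j\<in>A. cinner (u i) (u j) = (if i = j then 1 else 0))
    \<and> (\<forall>i\<in>A. K *v u i = complex_of_real (\<sigma> i) *s u i)"
  using finite[of A]
proof (induction A rule: finite_induct)
  case (insert j A)
  then obtain u \<sigma> where on: "\<And>i k. i \<in> A \<Longrightarrow> k \<in> A \<Longrightarrow> cinner (u i) (u k) = (if i = k then 1 else 0)"
    and ev: "\<And>i. i \<in> A \<Longrightarrow> K *v u i = complex_of_real (\<sigma> i) *s u i"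
    by metis
  have lin: "linear ((*v) K)"
    by (rule linearI)
       (simp_all add: vec_eq_iff matrix_vector_mult_def scaleR_sum_right distrib_left sum.distrib)
  define S where "S = {x. \<forall>i\<in>A. cinner (u i) x = 0}"
  have sub: "subspace S"
    by (auto simp: subspace_def S_def cinner_add_right cinner_scaleR_right) (simp add: cinner_def)
  have "S \<noteq> {0}"
  proof
    assume S0: "S = {0}"
    \<comment> \<open>A dimension count: \<open>L\<close> lists the coefficients along the known
      eigenvectors and pads with zeros. Were the complement trivial, \<open>L\<close> would be
      injective, hence surjective, although its entry at the new index \<open>j\<close> is always
      0.\<close>
    define L :: "complex^'n \<Rightarrow> complex^'n" where
      "L x = (\<chi> i. if i \<in> A then cinner (u i) x else 0)" for x
    have L: "linear L"
      by (rule linearI) (simp_all add: L_def vec_eq_iff cinner_add_right cinner_scaleR_right)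
    moreover have "inj L"
      unfolding linear_injective_0[OF L]
    proof safe
      fix x assume "L x = 0"
      then have "x \<in> S" by (auto simp: L_def S_def vec_eq_iff split: if_splits)
      then show "x = 0" by (simp add: S0)
    qed
    ultimately have "surj L" by (rule linear_injective_imp_surjective) simp
    then obtain x where "L x = axis j 1" by (metis surjD)
    then have "L x $ j = 1" by simp
    then show False using insert.hyps by (simp add: L_def)
  qed
  moreover have "(*v) K ` S \<subseteq> S"
    by (auto simp: S_def cinner_matrix_right herm ev cinner_scale_left)
  moreover have "(K *v x) \<bullet> y = x \<bullet> (K *v y)" for x y
    by (simp add: inner_eq_Re_cinner cinner_matrix_right herm)
  ultimately obtain x c where x: "x \<in> S" "norm x = 1" "K *v x = c *\<^sub>R x"
    using selfadjoint_eigenvector[OF lin _ sub] by metis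
  have x0: "cinner (u i) x = 0" "cinner x (u i) = 0" if "i \<in> A" for i
    using x(1) that cinner_commute[of x "u i"] by (auto simp: S_def)
  have "c *\<^sub>R x = complex_of_real c *s x"
    unfolding vec_eq_iff vector_scaleR_component vector_smult_component
    unfolding scaleR_conv_of_real by simp
  then show ?case
    using on ev x x0 insert.hyps cinner_self[of x]
    by (intro exI[of _ "u(j := x)"] exI[of _ "\<sigma>(j := c)"]) auto
qed simp

lemma hermitian_eigenbasis:
  fixes K :: "complex^'n^'n"
  assumes "ctranspose K = K"
  obtains u :: "'n \<Rightarrow> complex^'n" and \<sigma> where "\<And>i j. cinner (u i) (u j) = (if i = j then 1 else 0)"
    and "\<And>i. K *v u i = complex_of_real (\<sigma> i) *s u i"
  using hermitian_orthonormal_eigenvectors[OF assms, of UNIV] by auto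

context
  fixes u :: "'n::finite \<Rightarrow> complex^'n"
  assumes on: "\<And>i j. cinner (u i) (u j) = (if i = j then 1 else 0)"
begin

lemma orthonormal_unitary:
  shows "ctranspose (\<chi> k i. u i $ k) ** (\<chi> k i. u i $ k) = mat 1"
    and "(\<chi> k i. u i $ k) ** ctranspose (\<chi> k i. u i $ k) = mat 1"
proof -
  show *: "ctranspose (\<chi> k i. u i $ k) ** (\<chi> k i. u i $ k) = mat 1"
    using on by (simp add: vec_eq_iff ctranspose_def matrix_matrix_mult_def mat_def cinner_def)
  then show "(\<chi> k i. u i $ k) ** ctranspose (\<chi> k i. u i $ k) = mat 1"
    by (simp add: matrix_left_right_inverse)
qed

lemma parseval_cinner: "(\<Sum>i\<in>UNIV. (cmod (cinner (u i) x))\<^sup>2) = (norm x)\<^sup>2"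
proof -
  let ?U = "(\<chi> k i. u i $ k) :: complex^'n^'n"
  have "(ctranspose ?U *v x) $ i = cinner (u i) x" for i
    by (simp add: matrix_vector_mult_def ctranspose_def cinner_def)
  then have "complex_of_real (\<Sum>i\<in>UNIV. (cmod (cinner (u i) x))\<^sup>2) = cinner (ctranspose ?U *v x) (ctranspose ?U *v x)"
    unfolding cinner_def[of "ctranspose ?U *v x"] by (simp add: complex_norm_square mult.commute del: of_real_power)
  also have "\<dots> = cinner x ((?U ** ctranspose ?U) *v x)"
    unfolding matrix_vector_mul_assoc[symmetric] cinner_matrix_right[of x ?U] ..
  also have "\<dots> = complex_of_real ((norm x)\<^sup>2)"
    by (simp add: orthonormal_unitary cinner_self)
  finally show ?thesis
    unfolding of_real_eq_iff .
qed

text \<open>With the eigenvectors as columns of \<open>?U\<close> one has A U = U D, and the nonzero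
  determinant of \<open>?U\<close> cancels.\<close>

lemma det_orthonormal_eigenbasis:
  assumes ev: "\<And>i. A *v u i = d i *s u i"
  shows "det A = (\<Prod>i\<in>UNIV. d i)"
proof -
  let ?U = "(\<chi> k i. u i $ k) :: complex^'n^'n" and ?D = "(\<chi> i j. if i = j then d i else 0) :: complex^'n^'n"
  have "A ** ?U = ?U ** ?D"
  proof -
    have "(A ** ?U) $ k $ i = (A *v u i) $ k" for k i
      by (simp add: matrix_matrix_mult_def matrix_vector_mult_def)
    moreover have "(?U ** ?D) $ k $ i = d i * u i $ k" for k i
      by (simp add: matrix_matrix_mult_def if_distrib mult.commute cong: if_cong)
    ultimately show ?thesis
      by (simp add: vec_eq_iff ev)
  qed
  then have "det (A ** ?U) = det (?U ** ?D)"
    by (rule arg_cong)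
  then have "det A * det ?U = det ?D * det ?U"
    unfolding det_mul by (simp only: mult.commute)
  moreover have "det ?U \<noteq> 0"
  proof
    assume "det ?U = 0"
    then have "det (ctranspose ?U ** ?U) = 0" by (simp add: det_mul)
    then show False by (simp add: orthonormal_unitary)
  qed
  moreover have "det ?D = (\<Prod>i\<in>UNIV. d i)"
    by (subst det_diagonal) auto
  ultimately show ?thesis by simp
qed

end

subsection \<open>Circularly symmetric Gaussian vectors\<close>

lemma integrable_euclideanI:
  fixes f :: "'a \<Rightarrow> 'e::euclidean_space"
  assumes "\<And>b. b \<in> Basis \<Longrightarrow> integrable M (\<lambda>x. f x \<bullet> b)"
  shows "integrable M f"
proof -
  have "integrable M (\<lambda>x. \<Sum>b\<in>Basis. (f x \<bullet> b) *\<^sub>R b)"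
    using assms by (intro Bochner_Integration.integrable_sum integrable_scaleR_left) auto
  then show ?thesis by (simp add: euclidean_representation)
qed

lemma normal_law_moments:
  assumes N: "normal_law N"
  shows "integrable N (\<lambda>x. x)" and "integrable N (\<lambda>x. x\<^sup>2)"
proof -
  have "integrable N (\<lambda>x. x) \<and> integrable N (\<lambda>x. x\<^sup>2)"
    using N unfolding normal_law_def
  proof (elim disjE exE conjE)
    fix \<mu> assume "N = return borel \<mu>"
    then show ?thesis
      by (auto simp: integrable_iff_bounded nn_integral_return)
  next
    fix \<mu> \<sigma> :: real assume s: "0 < \<sigma>" and N: "N = density lborel (\<lambda>x. ennreal (normal_density \<mu> \<sigma> x))"
    have "normal_density \<mu> \<sigma> x * x\<^sup>2
        = normal_density \<mu> \<sigma> x * (x - \<mu>)\<^sup>2 + 2 * \<mu> * (normal_density \<mu> \<sigma> x * x) - \<mu>\<^sup>2 * normal_density \<mu> \<sigma> x" for x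
      by (simp add: power2_eq_square algebra_simps)
    then show ?thesis
      unfolding N using integrable_normal_moment[OF s, of \<mu> 2] integrable_normal_moment_nz_1[OF s, of \<mu>]
        integrable_normal_density[OF s, of \<mu>]
      by (simp add: integrable_real_density)
  qed
  then show "integrable N (\<lambda>x. x)" "integrable N (\<lambda>x. x\<^sup>2)" by auto
qed

text \<open>Expressing the exponent by the second moment treats point masses and proper normal laws
  alike.\<close>

lemma normal_law_iexp:
  assumes N: "normal_law N" and 0: "(LINT x|N. x) = 0"
  shows "(CLINT x|N. iexp x) = complex_of_real (exp (- (LINT x|N. x\<^sup>2) / 2))"
  using N unfolding normal_law_def
proof (elim disjE exE conjE)
  fix \<mu> assume N: "N = return borel \<mu>"
  with 0 have "\<mu> = 0" by (simp add: integral_return)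
  with N show ?thesis by (simp add: integral_return)
next
  fix \<mu> \<sigma> :: real assume s: "0 < \<sigma>" and N: "N = density lborel (\<lambda>x. ennreal (normal_density \<mu> \<sigma> x))"
  have "(LINT x|N. x) = \<mu>"
    unfolding N using integral_normal_moment_nz_1[OF s, of \<mu>] by (simp add: integral_real_density)
  with 0 have m: "\<mu> = 0" by simp
  have "(LINT x|N. x\<^sup>2) = \<sigma>\<^sup>2"
    unfolding N m using integral_normal_moment_even[OF s, of 0 1]
    by (simp add: integral_real_density fact_numeral)
  moreover have "(CLINT x|N. iexp x) = (CLINT x|lborel. normal_density 0 \<sigma> x *\<^sub>R iexp (1 * x))"
    unfolding N m by (subst integral_density) auto
  ultimately show ?thesis
    using integral_normal_density_iexp[OF s, of 1] by simp
qed

text \<open>A centred real Gaussian is determined by its variance, and circular symmetry ties that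
  variance to the Hermitian form of the covariance. The 4 combines the 2 from splitting the complex
  variance with the 2 in the normal characteristic function.\<close>

lemma (in prob_space)
  fixes Z :: "'a \<Rightarrow> complex^'n::finite"
  assumes Z: "cs_complex_gaussian M Z" and mean: "mean_vec M Z = 0"
  shows hermitian_covariance_mat: "ctranspose (covariance_mat M Z) = covariance_mat M Z"
    and cs_complex_gaussian_variance:
      "expectation (\<lambda>\<omega>. (a \<bullet> Z \<omega>)\<^sup>2) = Re (cinner a (covariance_mat M Z *v a)) / 2"
    and cs_complex_gaussian_iexp:
      "(CLINT \<omega>|M. iexp (a \<bullet> Z \<omega>)) = complex_of_real (exp (- Re (cinner a (covariance_mat M Z *v a)) / 4))"
proof -
  have Zm[measurable]: "Z \<in> borel_measurable M"
    and nl: "normal_law (distr M borel (\<lambda>\<omega>. a \<bullet> Z \<omega>))" for a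
    using Z by (auto simp: cs_complex_gaussian_def jointly_gaussian_def)
  have rot: "distr M borel (\<lambda>\<omega>. cis \<theta> *s Z \<omega>) = distr M borel Z" for \<theta>
    using Z by (auto simp: cs_complex_gaussian_def circularly_symmetric_def)
  have i1: "integrable M (\<lambda>\<omega>. a \<bullet> Z \<omega>)" and i2: "integrable M (\<lambda>\<omega>. (a \<bullet> Z \<omega>)\<^sup>2)" for a
    using normal_law_moments[OF nl[of a]] by (simp_all add: integrable_distr_eq)
  have Zi: "integrable M Z"
    by (rule integrable_euclideanI) (simp add: inner_commute[of "Z _"] i1)
  have "a \<bullet> expectation Z = 0" for a
    using mean by (simp add: mean_vec_def)
  then have mean0: "expectation (\<lambda>\<omega>. a \<bullet> Z \<omega>) = 0" for a
    using Zi by simp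
  have n2: "integrable M (\<lambda>\<omega>. (norm (Z \<omega>))\<^sup>2)"
    unfolding norm_power2_Basis using i2 by simp
  define C where "C \<omega> = (\<chi> i j. Z \<omega> $ i * cnj (Z \<omega> $ j))" for \<omega>
  have cov: "covariance_mat M Z = expectation C"
    by (simp add: covariance_mat_def mean C_def[abs_def])
  have Zk[measurable]: "(\<lambda>\<omega>. Z \<omega> $ k) \<in> borel_measurable M" for k
    by (rule borel_measurable_continuous_on[OF _ Zm]) (intro continuous_intros)
  \<comment> \<open>Entries of the Bochner integral are entrywise expectations only once
    integrability is known; each entry is dominated by the squared norm of \<open>Z\<close>, a sum
    of squared Gaussian coordinates.\<close>
  have "integrable M C"
  proof (rule integrable_euclideanI)
    fix b :: "complex^'n^'n" assume "b \<in> Basis"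
    then obtain i j c where b: "b = axis i (axis j c)" by (auto simp: Basis_vec_def)
    have "integrable M (\<lambda>\<omega>. Z \<omega> $ i * cnj (Z \<omega> $ j))"
    proof (rule Bochner_Integration.integrable_bound[OF n2])
      show "AE \<omega> in M. norm (Z \<omega> $ i * cnj (Z \<omega> $ j)) \<le> norm ((norm (Z \<omega>))\<^sup>2)"
        by (intro AE_I2) (auto simp: norm_mult power2_eq_square intro!: mult_mono Finite_Cartesian_Product.norm_nth_le)
      have [measurable]: "cnj \<in> borel_measurable borel"
        by (intro borel_measurable_continuous_onI continuous_intros)
      show "(\<lambda>\<omega>. Z \<omega> $ i * cnj (Z \<omega> $ j)) \<in> borel_measurable M" by measurable
    qed
    then show "integrable M (\<lambda>\<omega>. C \<omega> \<bullet> b)"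
      by (simp add: b inner_axis C_def)
  qed
  note Ci = this
  have bl: "bounded_linear (\<lambda>A :: complex^'n^'n. A $ i $ j)" for i j
    by (rule bounded_linear_compose[OF bounded_linear_vec_nth bounded_linear_vec_nth])
  have Cij: "covariance_mat M Z $ i $ j = expectation (\<lambda>\<omega>. C \<omega> $ i $ j)" for i j
    using integral_bounded_linear[OF bl Ci] by (simp add: cov)
  have Cint: "integrable M (\<lambda>\<omega>. C \<omega> $ i $ j)" for i j
    by (rule integrable_bounded_linear[OF bl Ci])
  show "ctranspose (covariance_mat M Z) = covariance_mat M Z"
  proof -
    have "cnj (expectation (\<lambda>\<omega>. C \<omega> $ j $ i)) = expectation (\<lambda>\<omega>. C \<omega> $ i $ j)" for i j
      by (subst Bochner_Integration.integral_cnj[symmetric]) (simp add: C_def mult.commute del: Bochner_Integration.integral_cnj)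
    then show ?thesis
      unfolding vec_eq_iff ctranspose_def by (simp add: Cij)
  qed
  have quad: "Re (cinner a (covariance_mat M Z *v a)) = expectation (\<lambda>\<omega>. (cmod (cinner a (Z \<omega>)))\<^sup>2)" for a
  proof -
    have "cinner a (covariance_mat M Z *v a) = (\<Sum>i\<in>UNIV. \<Sum>j\<in>UNIV. cnj (a $ i) * expectation (\<lambda>\<omega>. C \<omega> $ i $ j) * a $ j)"
      by (simp add: cinner_def matrix_vector_mult_def Cij sum_distrib_left mult.assoc)
    also have "\<dots> = expectation (\<lambda>\<omega>. \<Sum>i\<in>UNIV. \<Sum>j\<in>UNIV. cnj (a $ i) * C \<omega> $ i $ j * a $ j)"
      using Cint by simp
    also have "(\<lambda>\<omega>. \<Sum>i\<in>UNIV. \<Sum>j\<in>UNIV. cnj (a $ i) * C \<omega> $ i $ j * a $ j)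
        = (\<lambda>\<omega>. complex_of_real ((cmod (cinner a (Z \<omega>)))\<^sup>2))"
      unfolding complex_norm_square cinner_def cnj_sum sum_product by (simp add: C_def mult_ac)
    finally show ?thesis unfolding integral_complex_of_real by simp
  qed
  \<comment> \<open>Rotation by \<open>\<pi> / 2\<close> makes the real and imaginary parts of \<open>cinner a Z\<close> equally large in mean square.\<close>
  have same: "expectation (\<lambda>\<omega>. ((\<i> *s a) \<bullet> Z \<omega>)\<^sup>2) = expectation (\<lambda>\<omega>. (a \<bullet> Z \<omega>)\<^sup>2)" for a
  proof -
    have [measurable]: "(\<lambda>z. \<i> *s z :: complex^'n) \<in> borel_measurable borel"
      unfolding vector_scalar_mult_def
      by (intro borel_measurable_continuous_onI continuous_on_vec_lambda continuous_intros)
    have "(\<i> *s a) \<bullet> z = - (a \<bullet> (\<i> *s z))" for z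
      unfolding inner_eq_Re_cinner cinner_scale_left cinner_scale_right by simp
    then have "expectation (\<lambda>\<omega>. ((\<i> *s a) \<bullet> Z \<omega>)\<^sup>2) = expectation (\<lambda>\<omega>. (a \<bullet> (\<i> *s Z \<omega>))\<^sup>2)"
      by simp
    also have "\<dots> = (LINT z|distr M borel (\<lambda>\<omega>. \<i> *s Z \<omega>). (a \<bullet> z)\<^sup>2)"
      by (subst integral_distr) auto
    also have "\<dots> = expectation (\<lambda>\<omega>. (a \<bullet> Z \<omega>)\<^sup>2)"
      unfolding rot[of "pi / 2", unfolded cis_pi_half] by (subst integral_distr) auto
    finally show ?thesis .
  qed
  have var: "expectation (\<lambda>\<omega>. (a \<bullet> Z \<omega>)\<^sup>2) = Re (cinner a (covariance_mat M Z *v a)) / 2" for a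
  proof -
    have "(cmod (cinner a z))\<^sup>2 = (a \<bullet> z)\<^sup>2 + ((\<i> *s a) \<bullet> z)\<^sup>2" for z
      unfolding inner_ii_eq_Im_cinner by (simp add: inner_eq_Re_cinner cmod_power2)
    then have "Re (cinner a (covariance_mat M Z *v a))
        = expectation (\<lambda>\<omega>. (a \<bullet> Z \<omega>)\<^sup>2) + expectation (\<lambda>\<omega>. ((\<i> *s a) \<bullet> Z \<omega>)\<^sup>2)"
      unfolding quad using i2 by simp
    then show ?thesis by (simp add: same)
  qed
  then show "expectation (\<lambda>\<omega>. (a \<bullet> Z \<omega>)\<^sup>2) = Re (cinner a (covariance_mat M Z *v a)) / 2" .
  have "(CLINT \<omega>|M. iexp (a \<bullet> Z \<omega>)) = (CLINT x|distr M borel (\<lambda>\<omega>. a \<bullet> Z \<omega>). iexp x)"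
    by (subst integral_distr) auto
  also have "\<dots> = complex_of_real (exp (- (LINT x|distr M borel (\<lambda>\<omega>. a \<bullet> Z \<omega>). x\<^sup>2) / 2))"
    by (rule normal_law_iexp[OF nl]) (simp add: integral_distr mean0)
  also have "(LINT x|distr M borel (\<lambda>\<omega>. a \<bullet> Z \<omega>). x\<^sup>2) = Re (cinner a (covariance_mat M Z *v a)) / 2"
    by (subst integral_distr) (auto simp: var)
  finally show "(CLINT \<omega>|M. iexp (a \<bullet> Z \<omega>)) = complex_of_real (exp (- Re (cinner a (covariance_mat M Z *v a)) / 4))"
    by simp
qed

subsection \<open>Columns of complex matrices\<close>

text \<open>For orthonormal \<open>u\<close>, a real orthonormal basis of the matrix space: each
  \<open>u i\<close> yields two directions in each column, itself for \<open>True\<close> and its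
  multiple by the imaginary unit for \<open>False\<close>. The coordinates are the real and
  imaginary parts of the coefficient of that column along \<open>u i\<close>.\<close>

definition column_basis :: "('i \<Rightarrow> complex^'n) \<Rightarrow> 'i \<times> 'r \<times> bool \<Rightarrow> complex^'r^'n" where
  "column_basis u = (\<lambda>(i, r, b). \<chi> a r'. if r' = r then (if b then u i else \<i> *s u i) $ a else 0)"

lemma inner_eq_sum_column: "A \<bullet> B = (\<Sum>r\<in>UNIV. column r A \<bullet> column r B)"
  unfolding inner_vec_def column_def by (subst sum.swap) simp

lemma column_matrix_mult: "column r (A ** B) = A *v column r B"
  by (simp add: column_def matrix_matrix_mult_def matrix_vector_mult_def)

lemma column_column_basis:
  "column r' (column_basis u (i, r, b)) = (if r' = r then if b then u i else \<i> *s u i else 0)"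
  by (simp add: column_def column_basis_def vec_eq_iff)

lemma inner_column_basis:
  "column_basis u (i, r, b) \<bullet> w
    = (if b then Re (cinner (u i) (column r w)) else Im (cinner (u i) (column r w)))"
proof -
  have "column_basis u (i, r, b) \<bullet> w
      = (\<Sum>r'\<in>UNIV. if r' = r then (if b then u i else \<i> *s u i) \<bullet> column r w else 0)"
    unfolding inner_eq_sum_column column_column_basis by (intro sum.cong) auto
  then show ?thesis
    by (simp add: inner_eq_Re_cinner[symmetric] inner_ii_eq_Im_cinner[symmetric])
qed

lemma sum_column_index:
  "(\<Sum>j\<in>UNIV. f j) = (\<Sum>r\<in>UNIV. \<Sum>i\<in>UNIV. f (i, r, True) + f (i, r, False) :: 'b::comm_monoid_add)"
proof -
  have "(\<Sum>j\<in>UNIV. f j) = (\<Sum>i\<in>UNIV. \<Sum>r\<in>UNIV. \<Sum>b\<in>UNIV. f (i, r, b))"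
    by (simp only: sum.cartesian_product UNIV_Times_UNIV case_prod_unfold prod.collapse)
  also have "\<dots> = (\<Sum>i\<in>UNIV. \<Sum>r\<in>UNIV. f (i, r, True) + f (i, r, False))"
    by (simp add: UNIV_bool add.commute)
  finally show ?thesis by (subst sum.swap)
qed

text \<open>Pairing the two real frequencies into one complex coefficient yields one functional per
  column, the form to which independence of the columns applies.\<close>

lemma sum_inner_column_basis:
  fixes u :: "'n::finite \<Rightarrow> complex^'n" and \<tau> :: "'n \<times> 'r::finite \<times> bool \<Rightarrow> real"
  defines "p r \<equiv> \<Sum>i\<in>UNIV. (complex_of_real (\<tau> (i, r, True)) + \<i> * complex_of_real (\<tau> (i, r, False))) *s u i"
  shows "(\<Sum>j\<in>UNIV. \<tau> j * (column_basis u j \<bullet> w)) = (\<Sum>r\<in>UNIV. p r \<bullet> column r w)"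
  unfolding sum_column_index p_def inner_eq_Re_cinner cinner_sum_left cinner_scale_left inner_column_basis Re_sum
  by (simp add: algebra_simps)

context
  fixes u :: "'n::finite \<Rightarrow> complex^'n"
  assumes on: "\<And>i j. cinner (u i) (u j) = (if i = j then 1 else 0)"
begin

lemma norm_column_basis: "norm (column_basis u j) = 1"
proof -
  obtain i r b where j: "j = (i, r, b)" by (cases j)
  show ?thesis
    unfolding norm_eq_1 j inner_column_basis column_column_basis
    by (simp add: on cinner_scale_right)
qed

lemma parseval_column_basis: "(norm w)\<^sup>2 = (\<Sum>j\<in>UNIV. (column_basis u j \<bullet> w)\<^sup>2)"
proof -
  have "(norm w)\<^sup>2 = (\<Sum>r\<in>UNIV. (norm (column r w))\<^sup>2)"
    by (simp add: power2_norm_eq_inner inner_eq_sum_column[of w w])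
  also have "\<dots> = (\<Sum>r\<in>UNIV. \<Sum>i\<in>UNIV. (cmod (cinner (u i) (column r w)))\<^sup>2)"
    using parseval_cinner[OF on] by simp
  finally show ?thesis
    by (simp add: sum_column_index inner_column_basis cmod_power2)
qed

lemma cinner_eigenbasis_quadratic:
  assumes herm: "ctranspose K = K" and ev: "\<And>i. K *v u i = complex_of_real (\<sigma> i) *s u i"
  shows "cinner (\<Sum>i\<in>UNIV. c i *s u i) (K *v (\<Sum>i\<in>UNIV. c i *s u i))
    = (\<Sum>i\<in>UNIV. complex_of_real (\<sigma> i * (cmod (c i))\<^sup>2))"
proof -
  define p where "p = (\<Sum>i\<in>UNIV. c i *s u i)"
  have "cinner (u i) p = c i" for i
    by (simp add: p_def cinner_sum_right cinner_scale_right on if_distrib cong: if_cong)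
  then have "cinner (u i) (K *v p) = complex_of_real (\<sigma> i) * c i" for i
    by (simp add: cinner_matrix_right herm ev cinner_scale_left)
  then have "cinner p (K *v p) = (\<Sum>i\<in>UNIV. cnj (c i) * (complex_of_real (\<sigma> i) * c i))"
    by (subst p_def) (simp add: cinner_sum_left cinner_scale_left)
  also have "\<dots> = (\<Sum>i\<in>UNIV. complex_of_real (\<sigma> i * (cmod (c i))\<^sup>2))"
    by (intro sum.cong refl) (simp add: complex_norm_square mult_ac del: of_real_power)
  finally show ?thesis unfolding p_def .
qed

end

subsection \<open>Sensing mutual information\<close>

theorem theorem1:
  fixes M :: "'w measure"
    and Xb :: "'c::finite \<Rightarrow> complex^'t::finite^'x::finite"
    and X :: "complex^('c \<times> 't)^('c \<times> 'x)"
    and G :: "'w \<Rightarrow> complex^'r::finite^('c \<times> 't)"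
    and W :: "'w \<Rightarrow> complex^'r^('c \<times> 'x)"
    and Y :: "'w \<Rightarrow> complex^'r^('c \<times> 'x)"
    and Sigma :: "complex^('c \<times> 't)^('c \<times> 't)"
    and s2 :: real
  assumes "prob_space M"
    and "s2 > 0"
    and "X = block_diag Xb"
    and "prob_space.indep_vars M (\<lambda>_. borel) (\<lambda>r \<omega>. column r (G \<omega>)) UNIV"
    and "\<And>r. cs_complex_gaussian M (\<lambda>\<omega>. column r (G \<omega>))"
    and "\<And>r. mean_vec M (\<lambda>\<omega>. column r (G \<omega>)) = 0"
    and "\<And>r. covariance_mat M (\<lambda>\<omega>. column r (G \<omega>)) = Sigma"
    and "Sigma = (LINT \<omega>|M. G \<omega> ** ctranspose (G \<omega>)) /\<^sub>R real CARD('r)"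
    and "prob_space.indep_vars M (\<lambda>_. borel) (\<lambda>(a, r) \<omega>. W \<omega> $ a $ r) UNIV"
    and "\<And>a r. distributed M lborel (\<lambda>\<omega>. W \<omega> $ a $ r) (\<lambda>z. ennreal (cn_density s2 z))"
    and "indep_rv M borel G borel W"
    and "\<And>\<omega>. \<omega> \<in> space M \<Longrightarrow> Y \<omega> = X ** G \<omega> + W \<omega>"
  shows "let I = prob_space.mutual_information M 2 borel borel G Y;
             D = det (X ** Sigma ** ctranspose X + s2 *\<^sub>R mat 1)
         in I = prob_space.entropy M 2 lborel Y - prob_space.entropy M 2 lborel W
            \<and> D \<in> \<real> \<and> Re D > 0
            \<and> I = real CARD('r) * log 2 (s2 powi (- int (CARD('x) * CARD('c))) * Re D)"
proof -
  interpret prob_space M by fact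
  interpret information_space M 2 by standard simp
  note s2 = assms(2) and G_indep = assms(4) and cov = assms(7)
  note gauss = assms(5) and mean = assms(6)
  have [measurable]: "random_variable borel (\<lambda>\<omega>. column r (G \<omega>))" for r
    using G_indep by (simp add: indep_vars_def)
  have herm_Sigma: "ctranspose Sigma = Sigma"
    using hermitian_covariance_mat[OF gauss mean] by (simp add: cov)
  \<comment> \<open>The common covariance of the columns of the noiseless echo
    \<open>X ** G \<omega>\<close>.\<close>
  define S where "S = X ** Sigma ** ctranspose X"
  have hermS: "ctranspose S = S"
    by (simp add: S_def ctranspose_mult herm_Sigma matrix_mul_assoc)
  have quadS: "cinner p (S *v p) = cinner (ctranspose X *v p) (Sigma *v (ctranspose X *v p))" for p
    by (simp add: S_def matrix_vector_mul_assoc[symmetric] cinner_matrix_right[of p X])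
  obtain u :: "'c \<times> 'x \<Rightarrow> complex^('c \<times> 'x)" and \<sigma> where on: "\<And>i j. cinner (u i) (u j) = (if i = j then 1 else 0)"
    and ev: "\<And>i. S *v u i = complex_of_real (\<sigma> i) *s u i"
    using hermitian_eigenbasis[OF hermS] by blast
  have sigma_nn: "0 \<le> \<sigma> i" for i
  proof -
    \<comment> \<open>Any column serves, since all share the covariance \<open>Sigma\<close>; the
      eigenvalue appears as twice the mean square of a real functional of it.\<close>
    fix r :: 'r
    have "\<sigma> i = Re (cinner (u i) (S *v u i))"
      by (simp add: ev cinner_scale_right on)
    also have "\<dots> = 2 * expectation (\<lambda>\<omega>. ((ctranspose X *v u i) \<bullet> column r (G \<omega>))\<^sup>2)"
      unfolding quadS cs_complex_gaussian_variance[OF gauss mean] cov by simp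
    also have "\<dots> \<ge> 0" by simp
    finally show ?thesis .
  qed
  \<comment> \<open>The index \<open>fst j\<close> selects the eigenvector: both real coordinates
    belonging to it, in every column, have variance \<open>\<sigma> (fst j) / 2\<close>.\<close>
  have char: "(CLINT \<omega>|M. iexp (\<Sum>j\<in>UNIV. \<tau> j * (column_basis u j \<bullet> (X ** G \<omega>))))
      = complex_of_real (exp (- (\<Sum>j\<in>UNIV. \<sigma> (fst j) / 2 * (\<tau> j)\<^sup>2) / 2))" for \<tau>
  proof -
    define c where "c r i = complex_of_real (\<tau> (i, r, True)) + \<i> * complex_of_real (\<tau> (i, r, False))" for r i
    define a where "a r = ctranspose X *v (\<Sum>i\<in>UNIV. c r i *s u i)" for r
    have "(\<Sum>j\<in>UNIV. \<tau> j * (column_basis u j \<bullet> (X ** G \<omega>))) = (\<Sum>r\<in>UNIV. a r \<bullet> column r (G \<omega>))" for \<omega>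
      unfolding sum_inner_column_basis a_def c_def column_matrix_mult inner_eq_Re_cinner
      by (simp add: cinner_matrix_right)
    then have "(CLINT \<omega>|M. iexp (\<Sum>j\<in>UNIV. \<tau> j * (column_basis u j \<bullet> (X ** G \<omega>))))
        = (CLINT \<omega>|M. (\<Prod>r\<in>UNIV. iexp (a r \<bullet> column r (G \<omega>))))"
      by (simp add: sum_distrib_left exp_sum)
    also have "\<dots> = (\<Prod>r\<in>UNIV. (CLINT \<omega>|M. iexp (a r \<bullet> column r (G \<omega>))))"
    proof (rule indep_vars_lebesgue_integral)
      show "indep_vars (\<lambda>_. borel) (\<lambda>r \<omega>. iexp (a r \<bullet> column r (G \<omega>))) UNIV"
        by (rule indep_vars_compose2[OF G_indep]) measurable
      show "complex_integrable M (\<lambda>\<omega>. iexp (a r \<bullet> column r (G \<omega>)))" for r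
      proof (rule integrable_iexp)
        show "random_variable borel (\<lambda>\<omega>. complex_of_real (a r \<bullet> column r (G \<omega>)))"
          by measurable
      qed simp
    qed simp
    also have "\<dots> = (\<Prod>r\<in>UNIV. complex_of_real (exp (- Re (cinner (a r) (Sigma *v a r)) / 4)))"
      unfolding cs_complex_gaussian_iexp[OF gauss mean] cov ..
    also have "\<dots> = complex_of_real (exp (\<Sum>r\<in>UNIV. - Re (cinner (a r) (Sigma *v a r)) / 4))"
      by (simp add: exp_sum)
    also have "(\<Sum>r\<in>UNIV. - Re (cinner (a r) (Sigma *v a r)) / 4)
        = - (\<Sum>j\<in>UNIV. \<sigma> (fst j) / 2 * (\<tau> j)\<^sup>2) / 2"
    proof -
      have "Re (cinner (a r) (Sigma *v a r))
          = (\<Sum>i\<in>UNIV. \<sigma> i * (\<tau> (i, r, True))\<^sup>2 + \<sigma> i * (\<tau> (i, r, False))\<^sup>2)" for r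
        unfolding a_def quadS[symmetric] cinner_eigenbasis_quadratic[OF on hermS ev]
        by (simp add: c_def cmod_power2 algebra_simps)
      then have "(\<Sum>j\<in>UNIV. \<sigma> (fst j) / 2 * (\<tau> j)\<^sup>2) = (\<Sum>r\<in>UNIV. Re (cinner (a r) (Sigma *v a r)) / 2)"
        by (simp only: sum_column_index) (simp add: sum_divide_distrib add_divide_distrib)
      then show ?thesis
        by (simp add: sum_negf sum_divide_distrib[symmetric])
    qed
    finally show ?thesis .
  qed
  have mult: "(\<lambda>g. X ** g) \<in> borel_measurable borel"
    unfolding matrix_matrix_mult_def
    by (intro borel_measurable_continuous_onI continuous_on_vec_lambda continuous_intros)
  note channel = assms(11) half_gt_zero[OF s2] distributed_cn_matrix[OF s2 assms(9,10)] mult assms(12)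
    finite_class.finite_UNIV
  have card: "card (UNIV :: (('c \<times> 'x) \<times> 'r \<times> bool) set) = DIM(complex^'r^('c \<times> 'x))"
    by simp
  have I1: "mutual_information 2 borel borel G Y = entropy 2 lborel Y - entropy 2 lborel W"
    by (rule mutual_information_gaussian_channel_entropy[OF channel card
          parseval_column_basis[OF on] norm_column_basis[OF on] _ char]) (simp_all add: sigma_nn)
  have I2: "mutual_information 2 borel borel G Y
      = (\<Sum>j\<in>(UNIV :: (('c \<times> 'x) \<times> 'r \<times> bool) set). log 2 ((\<sigma> (fst j) / 2 + s2 / 2) / (s2 / 2))) / 2"
    by (rule mutual_information_gaussian_channel[OF channel card
          parseval_column_basis[OF on] norm_column_basis[OF on] _ char]) (simp_all add: sigma_nn)
  \<comment> \<open>Adding a multiple of the identity keeps the eigenvectors and shifts every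
    eigenvalue by \<open>s2\<close>, so the determinant is a product of positive reals.\<close>
  have D: "det (S + s2 *\<^sub>R mat 1) = complex_of_real (\<Prod>i\<in>UNIV. \<sigma> i + s2)"
  proof -
    have "(s2 *\<^sub>R mat 1 :: complex^('c \<times> 'x)^('c \<times> 'x)) *v x = complex_of_real s2 *s x" for x
      by (simp add: vec_eq_iff matrix_vector_mult_def mat_def if_distrib if_distribR cong: if_cong)
         (simp add: scaleR_conv_of_real)
    then have "(S + s2 *\<^sub>R mat 1) *v u i = complex_of_real (\<sigma> i + s2) *s u i" for i
      by (simp add: matrix_vector_mult_add_rdistrib ev vec_eq_iff algebra_simps)
    from det_orthonormal_eigenbasis[OF on this] show ?thesis by simp
  qed
  have pos: "0 < \<sigma> i + s2" for i using sigma_nn[of i] s2 by simp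
  have "mutual_information 2 borel borel G Y
      = (\<Sum>r\<in>(UNIV :: 'r set). \<Sum>i\<in>UNIV. log 2 ((\<sigma> i + s2) / s2))"
  proof -
    \<comment> \<open>The halves of signal and noise variance cancel in the ratio, and the two
      Boolean indices per eigenvalue cancel the outer 1/2.\<close>
    have "(x / 2 + s2 / 2) / (s2 / 2) = (x + s2) / s2" for x
      using s2 by (simp add: field_simps)
    then show ?thesis
      unfolding I2 by (simp add: sum_column_index sum_distrib_left[symmetric])
  qed
  also have "\<dots> = real CARD('r) * log 2 (\<Prod>i\<in>UNIV. (\<sigma> i + s2) / s2)"
    using pos s2 by (simp add: log_def ln_prod less_imp_neq[symmetric] sum_divide_distrib)
  \<comment> \<open>One factor \<open>s2\<close> is divided out per eigenvalue, that is, per row of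
    the echo.\<close>
  also have "(\<Prod>i\<in>UNIV. (\<sigma> i + s2) / s2) = s2 powi (- int (CARD('x) * CARD('c))) * (\<Prod>i\<in>UNIV. \<sigma> i + s2)"
    unfolding power_int_minus power_int_of_nat prod_dividef by (simp add: divide_inverse mult.commute)
  finally have I3: "mutual_information 2 borel borel G Y
      = real CARD('r) * log 2 (s2 powi (- int (CARD('x) * CARD('c))) * Re (det (S + s2 *\<^sub>R mat 1)))"
    unfolding D Re_complex_of_real .
  have "det (S + s2 *\<^sub>R mat 1) \<in> \<real>" "Re (det (S + s2 *\<^sub>R mat 1)) > 0"
    unfolding D Re_complex_of_real using pos by (auto intro!: prod_pos simp del: of_real_prod)
  with I1 I3 show ?thesis
    unfolding Let_def S_def by blast
qed

end
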